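(* Consider $n$ agents $\dot p_i=v_i$, $\dot v_i=F_i(p_i,v_i,\Gamma_i)$, $i\in\mathcal N=\{1,\dots,n\}$, with $p_i,v_i,\Gamma_i\in\mathbb R^N$, interconnected by the directed graph $\mathcal G$ with follower set $\mathfrak F$ and leader set $\mathfrak L$, where for $i\in\mathfrak F$ the functions $F_i:\mathbb R^N\times\mathbb R^N\times\mathbb R^N\to\mathbb R^N$ (possibly different for different $i$) are continuous and locally Lipschitz in their arguments, and $F_i\equiv\Gamma_i$ for $i\in\mathfrak L$. Suppose that the graph assumption, the bounded-blackout assumption, the common-sampling assumption and the leader-motion assumption (all stated in the context) hold. Put $\hat v_i\equiv v_i$ for $i\in\mathfrak L$. For each $i\in\mathfrak F$ define the reference velocity $$v_{r_i}:=-\lambda_i(p_i-\eta_{i,1})+\hat v_i,$$ where $$\dot\eta_{i,1}=-k_{p_i}(\eta_{i,1}-\eta_{i,2})+\hat v_i,\qquad \dot\eta_{i,2}=-k_{d_i}\Big(\eta_{i,2}-\frac1{\kappa_i}\sum_{j=1}^n a_{ij}\vartheta_{ij}\Big)+\hat v_i,$$ $$\dot{\hat v}_i=-L_{p_i}(\hat v_i-\sigma_{i,1}),\qquad \dot\sigma_{i,1}=-L_{d_i}\Big(\sigma_{i,1}-\frac1{\kappa_i}\sum_{j=1}^n a_{ij}\hat v_j(t_{k_{ij}^{\mathrm m}(t)})\Big),$$ $$\vartheta_{ij}(t)=p_j(t_{k_{ij}^{\mathrm m}(t)})+\hat v_j(t_{k_{ij}^{\mathrm m}(t)})\,(t-k_{ij}^{\mathrm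 m}(t)T)\quad\text{for }(j,i)\in\mathcal E,$$ with arbitrary scalar gains $\lambda_i,k_{p_i},k_{d_i},L_{p_i},L_{d_i}>0$. Suppose that for each $i\in\mathfrak F$ there exists a control input $\Gamma_i$ (and let it be applied) that guarantees: (i) the error $e_i:=v_i-v_{r_i}$ is uniformly bounded; (ii) if $\dot v_{r_i}$ and $v_{r_i}$ are uniformly bounded, then $e_i(t)\to0$ as $t\to+\infty$. Then, for arbitrary initial conditions, $\boldsymbol v_F$ and $\mathbf p_F+(\mathcal L_1^{-1}\mathcal L_2\otimes I_N)\mathbf p_L$ are uniformly bounded, $v_i(t)\to v_d$ for every $i\in\mathfrak F$, and $\mathbf p_F(t)+(\mathcal L_1^{-1}\mathcal L_2\otimes I_N)\mathbf p_L(t)\to0$ as $t\to+\infty$.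
   Context: Graph. $\mathcal G=(\mathcal N,\mathcal E,\mathcal A)$ is a weighted directed graph on $\mathcal N=\{1,\dots,n\}$ with adjacency matrix $\mathcal A=[a_{ij}]\in\mathbb R^{n\times n}$: $a_{ii}=0$, $a_{ij}>0$ if $(j,i)\in\mathcal E$ (agent $i$ can receive information from agent $j$), and $a_{ij}=0$ otherwise. The Laplacian $\mathcal L=[l_{ij}]$ has $l_{ii}=\sum_j a_{ij}$ and $l_{ij}=-a_{ij}$ for $i\ne j$. There are $m<n$ followers $\mathfrak F=\{1,\dots,m\}$ and $n-m$ leaders $\mathfrak L=\{m+1,\dots,n\}$: a leader $i$ has $(j,i)\notin\mathcal E$ for all $j$; a follower $i$ has $(j,i)\in\mathcal E$ for at least one $j$. Hence $\mathcal L=\begin{bmatrix}\mathcal L_1&\mathcal L_2\\0&0\end{bmatrix}$ with $\mathcal L_1\in\mathbb R^{m\times m}$, $\mathcal L_2\in\mathbb R^{m\times(n-m)}$. For $i\in\mathfrak F$, $\kappa_i:=\sum_{j=1}^n a_{ij}>0$. Under the graph assumption below, $\mathcal L_1$ is invertible. $\otimes$ is the Kronecker product; $\mathbf x_F$, $\mathbf x_L$ are the column stacks of $x_i$ over $i\in\mathfrak F$, respectively $i\in\mathfrak L$. Graph assumption: for each $i\in\mathfrak F$ there is at least one $j\in\mathfrak L$ with a directed path from $j$ to $i$ in $\mathcal G$. Communication. For each $(j,i)\in\mathcal E$ there is a strictly increasing unbounded sequence of indices $\mathscr S_{ij}\subseteq\{0,1,2,\dots\}$; agent $j$ sends data to agent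 $i$ at the instants $t_{k}$, $k\in\mathscr S_{ij}$ (written $t_{k_{ij}}$, $k_{ij}\in\mathscr S_{ij}$), and the data sent at $t_{k}$ is received at $t_{k}+\tau_{k}$, with delay $\tau_{k}\in[0,+\infty]$ that may depend on the edge ($\tau_k=+\infty$ meaning that the data is lost). The transmitted data consist of $p_j(t_k)$, $\hat v_j(t_k)$ and the index $k$. $k_{ij}^{\mathrm m}(t)$ is the largest index $k\in\mathscr S_{ij}$ such that the data sent by $j$ at $t_k$ has been delivered to $i$ by time $t$, i.e. $t_k+\tau_k\le t$; before the first delivery one takes $k_{ij}^{\mathrm m}(t)=0$, $t_{k_{ij}^{\mathrm m}(t)}=0$. Bounded-blackout assumption: there is $T^*>0$ such that for each $(j,i)\in\mathcal E$ there is a strictly increasing infinite subsequence $\{k_{ij}^{(1)},k_{ij}^{(2)},\dots\}\subseteq\mathscr S_{ij}$ with $t_{k_{ij}^{(l+1)}}+\tau_{k_{ij}^{(l+1)}}-t_{k_{ij}^{(l)}}\le T^*$ for all $l\ge1$. Common-sampling assumption: $t_{k_{ij}}=k_{ij}T$ for all $(j,i)\in\mathcal E$, $k_{ij}\in\mathscr S_{ij}$, where $T>0$ is a sampling period known to all agents. Leader-motion assumption: for all $i\in\mathfrak L$, $\Gamma_i$ is a uniformly bounded function such that, for arbitrary initial conditions, $v_i$ is uniformly bounded, $\dot v_i(t)\to0$ and $v_i(t)\to v_d$, where $v_d\in\mathbb R^N$ is common to all leaders. All systems evolve on $t\ge0$; differential equations with right-hand sides discontinuous in time are understood in the Carathéodory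 sense (derivatives are given by the right-hand sides). "Uniformly bounded" means bounded on $[0,\infty)$ along the given solution. Closed-loop solutions under the inputs $\Gamma_i$ are taken to be defined for all $t\ge0$, and properties (i)-(ii) are understood along closed-loop solutions with arbitrary initial conditions. *)

theory Defs
  imports "HOL-Analysis.Analysis"
begin

text \<open>
  Agents have type \<open>'f + 'l\<close>: \<open>Inl\<close> injects the \<open>m = CARD('f)\<close> followers and \<open>Inr\<close> the
  \<open>n - m = CARD('l)\<close> leaders.  An edge \<open>(j, i)\<close> means that \<open>i\<close> can receive information
  from \<open>j\<close>, whereas matrices and the families \<open>samp\<close>, \<open>delay\<close> are indexed receiver
  first, as in \<open>a\<^sub>i\<^sub>j\<close>.  All signals are functions on \<open>real\<close> of which only the
  restriction to \<open>t \<ge> 0\<close> matters.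
\<close>

section \<open>Graph\<close>

record ('i::finite) network =
  edges :: "('i \<times> 'i) set"
  weight :: "real^'i^'i"
  samp :: "'i \<Rightarrow> 'i \<Rightarrow> nat set"
  inst :: "nat \<Rightarrow> real"
  delay :: "'i \<Rightarrow> 'i \<Rightarrow> nat \<Rightarrow> ereal"
  period :: real

definition weighted_digraph :: "('i::finite, 'z) network_scheme \<Rightarrow> bool" where
  "weighted_digraph G \<longleftrightarrow>
     (\<forall>i. weight G $ i $ i = 0) \<and>
     (\<forall>i j. ((j, i) \<in> edges G \<longrightarrow> weight G $ i $ j > 0) \<and>
            ((j, i) \<notin> edges G \<longrightarrow> weight G $ i $ j = 0))"

definition leader_follower :: "('f::finite + 'l::finite, 'z) network_scheme \<Rightarrow> bool" where
  "leader_follower G \<longleftrightarrow>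
     (\<forall>l j. (j, Inr l) \<notin> edges G) \<and> (\<forall>i. \<exists>j. (j, Inl i) \<in> edges G)"

definition leader_rooted :: "('f::finite + 'l::finite, 'z) network_scheme \<Rightarrow> bool" where
  "leader_rooted G \<longleftrightarrow> (\<forall>i. \<exists>l. (Inr l, Inl i) \<in> (edges G)\<^sup>+)"

definition laplacian :: "('i::finite, 'z) network_scheme \<Rightarrow> real^'i^'i" where
  "laplacian G = (\<chi> i j. if i = j then \<Sum>k\<in>UNIV. weight G $ i $ k else - weight G $ i $ j)"

definition laplacian1 :: "('f::finite + 'l::finite, 'z) network_scheme \<Rightarrow> real^'f^'f" where
  "laplacian1 G = (\<chi> i j. laplacian G $ Inl i $ Inl j)"

definition laplacian2 :: "('f::finite + 'l::finite, 'z) network_scheme \<Rightarrow> real^'l^'f" where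
  "laplacian2 G = (\<chi> i l. laplacian G $ Inl i $ Inr l)"

definition in_weight :: "('f::finite + 'l::finite, 'z) network_scheme \<Rightarrow> 'f \<Rightarrow> real" where
  "in_weight G i = (\<Sum>j\<in>UNIV. weight G $ Inl i $ j)"

text \<open>Block matrices and column stacks are indexed by pairs (block, position in the block).\<close>

definition kronecker ::
  "real^'b^'a \<Rightarrow> real^'d^'c \<Rightarrow> real^('b::finite \<times> 'd::finite)^('a::finite \<times> 'c::finite)" where
  "kronecker A B = (\<chi> r s. A $ fst r $ fst s * B $ snd r $ snd s)"

definition stack :: "('i::finite \<Rightarrow> real^'d::finite) \<Rightarrow> real^('i \<times> 'd)" where
  "stack x = (\<chi> r. x (fst r) $ snd r)"


section \<open>Communication\<close>

definition communication :: "('i::finite, 'z) network_scheme \<Rightarrow> bool" where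
  "communication G \<longleftrightarrow>
     (\<forall>(j, i) \<in> edges G. infinite (samp G i j) \<and> (\<forall>k \<in> samp G i j. 0 \<le> delay G i j k))"

definition common_sampling :: "('i::finite, 'z) network_scheme \<Rightarrow> bool" where
  "common_sampling G \<longleftrightarrow>
     period G > 0 \<and>
     (\<forall>(j, i) \<in> edges G. \<forall>k \<in> samp G i j. inst G k = real k * period G)"

definition bounded_blackout :: "('i::finite, 'z) network_scheme \<Rightarrow> bool" where
  "bounded_blackout G \<longleftrightarrow>
     (\<exists>Tstar > 0. \<forall>(j, i) \<in> edges G. \<exists>s :: nat \<Rightarrow> nat.
        strict_mono s \<and> range s \<subseteq> samp G i j \<and>
        (\<forall>l. ereal (inst G (s (Suc l))) + delay G i j (s (Suc l)) - ereal (inst G (s l))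
               \<le> ereal Tstar))"

definition delivered ::
  "('i::finite, 'z) network_scheme \<Rightarrow> 'i \<Rightarrow> 'i \<Rightarrow> real \<Rightarrow> nat set" where
  "delivered G i j t = {k \<in> samp G i j. ereal (inst G k) + delay G i j k \<le> ereal t}"

text \<open>
  Under common sampling with nonnegative delays, the set of delivered indices is finite
  on every edge, so that \<open>Max\<close> is meaningful.  The initial values are used before the
  first delivery, whether or not index 0 belongs to the sampling set.
\<close>

definition last_index :: "('i::finite, 'z) network_scheme \<Rightarrow> 'i \<Rightarrow> 'i \<Rightarrow> real \<Rightarrow> nat" where
  "last_index G i j t = (if delivered G i j t = {} then 0 else Max (delivered G i j t))"

definition last_inst :: "('i::finite, 'z) network_scheme \<Rightarrow> 'i \<Rightarrow> 'i \<Rightarrow> real \<Rightarrow> real" where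
  "last_inst G i j t = (if delivered G i j t = {} then 0 else inst G (last_index G i j t))"


section \<open>Closed loop\<close>

definition uniformly_bounded :: "(real \<Rightarrow> 'a::real_normed_vector) \<Rightarrow> bool" where
  "uniformly_bounded x \<longleftrightarrow> bounded (x ` {0..})"

text \<open>\<open>caratheodory x f\<close>: \<open>x' = f\<close> on \<open>t \<ge> 0\<close>, for \<open>f\<close> the right-hand side along the solution.\<close>

definition caratheodory :: "(real \<Rightarrow> 'a::euclidean_space) \<Rightarrow> (real \<Rightarrow> 'a) \<Rightarrow> bool" where
  "caratheodory x f \<longleftrightarrow>
     (\<forall>t\<ge>0. f absolutely_integrable_on {0..t} \<and> x t = x 0 + integral {0..t} f)"

record 'f gains =
  lam :: "'f \<Rightarrow> real"
  kp :: "'f \<Rightarrow> real"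
  kd :: "'f \<Rightarrow> real"
  Lp :: "'f \<Rightarrow> real"
  Ld :: "'f \<Rightarrow> real"

definition positive_gains :: "('f, 'z) gains_scheme \<Rightarrow> bool" where
  "positive_gains K \<longleftrightarrow> (\<forall>i. lam K i > 0 \<and> kp K i > 0 \<and> kd K i > 0 \<and> Lp K i > 0 \<and> Ld K i > 0)"

record ('f, 'l, 'd::finite) trajectory =
  pos :: "'f + 'l \<Rightarrow> real \<Rightarrow> real^'d"
  vel :: "'f + 'l \<Rightarrow> real \<Rightarrow> real^'d"
  vhat :: "'f + 'l \<Rightarrow> real \<Rightarrow> real^'d"
  eta1 :: "'f \<Rightarrow> real \<Rightarrow> real^'d"
  eta2 :: "'f \<Rightarrow> real \<Rightarrow> real^'d"
  sigma1 :: "'f \<Rightarrow> real \<Rightarrow> real^'d"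

definition weighted_mean ::
  "('f::finite + 'l::finite, 'z) network_scheme \<Rightarrow> 'f \<Rightarrow> ('f + 'l \<Rightarrow> real^'d::finite) \<Rightarrow> real^'d"
where
  "weighted_mean G i y = (1 / in_weight G i) *\<^sub>R (\<Sum>j\<in>UNIV. weight G $ Inl i $ j *\<^sub>R y j)"

definition extrapolation ::
  "('f::finite + 'l::finite) network \<Rightarrow> ('f, 'l, 'd::finite) trajectory
     \<Rightarrow> 'f + 'l \<Rightarrow> 'f + 'l \<Rightarrow> real \<Rightarrow> real^'d" where
  "extrapolation G z i j t =
     pos z j (last_inst G i j t)
     + (t - real (last_index G i j t) * period G) *\<^sub>R vhat z j (last_inst G i j t)"

definition reference_velocity ::
  "'f gains \<Rightarrow> ('f, 'l, 'd::finite) trajectory \<Rightarrow> 'f \<Rightarrow> real \<Rightarrow> real^'d" where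
  "reference_velocity K z i t =
     - lam K i *\<^sub>R (pos z (Inl i) t - eta1 z i t) + vhat z (Inl i) t"

definition velocity_error ::
  "'f gains \<Rightarrow> ('f, 'l, 'd::finite) trajectory \<Rightarrow> 'f \<Rightarrow> real \<Rightarrow> real^'d" where
  "velocity_error K z i t = vel z (Inl i) t - reference_velocity K z i t"

text \<open>
  \<open>\<Gamma> i z\<close> is the set of input signals that the control law of agent \<open>i\<close> may generate along
  the trajectory \<open>z\<close>.  It is a set, rather than a single signal, in order to cover dynamic
  control laws whose internal states have arbitrary initial values.  Initial conditions
  are unconstrained.
\<close>

definition closed_loop ::
  "('f + 'l \<Rightarrow> real^'d \<Rightarrow> real^'d \<Rightarrow> real^'d \<Rightarrow> real^'d)
     \<Rightarrow> ('f::finite + 'l::finite) network \<Rightarrow> 'f gains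
     \<Rightarrow> ('f + 'l \<Rightarrow> ('f, 'l, 'd::finite) trajectory \<Rightarrow> (real \<Rightarrow> real^'d) set)
     \<Rightarrow> ('f, 'l, 'd) trajectory \<Rightarrow> ('f + 'l \<Rightarrow> real \<Rightarrow> real^'d) \<Rightarrow> bool" where
  "closed_loop F G K \<Gamma> z u \<longleftrightarrow>
     (\<forall>i. u i \<in> \<Gamma> i z) \<and>
     (\<forall>i. caratheodory (pos z i) (vel z i)) \<and>
     (\<forall>i. caratheodory (vel z i) (\<lambda>t. F i (pos z i t) (vel z i t) (u i t))) \<and>
     (\<forall>l. \<forall>t\<ge>0. vhat z (Inr l) t = vel z (Inr l) t) \<and>
     (\<forall>i.
        caratheodory (eta1 z i)
          (\<lambda>t. - kp K i *\<^sub>R (eta1 z i t - eta2 z i t) + vhat z (Inl i) t) \<and>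
        caratheodory (eta2 z i)
          (\<lambda>t. - kd K i *\<^sub>R (eta2 z i t
                 - weighted_mean G i (\<lambda>j. extrapolation G z (Inl i) j t))
               + vhat z (Inl i) t) \<and>
        caratheodory (vhat z (Inl i))
          (\<lambda>t. - Lp K i *\<^sub>R (vhat z (Inl i) t - sigma1 z i t)) \<and>
        caratheodory (sigma1 z i)
          (\<lambda>t. - Ld K i *\<^sub>R (sigma1 z i t
                 - weighted_mean G i (\<lambda>j. vhat z j (last_inst G (Inl i) j t)))))"

text \<open>
  The inputs of leaders may have discontinuities, so the derivative of a leader's velocity
  is the right-hand side of its differential equation.
\<close>

definition leader_motion ::
  "('f + 'l \<Rightarrow> real^'d \<Rightarrow> real^'d \<Rightarrow> real^'d \<Rightarrow> real^'d) \<Rightarrow> real^'d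
     \<Rightarrow> ('f, 'l, 'd::finite) trajectory \<Rightarrow> ('f + 'l \<Rightarrow> real \<Rightarrow> real^'d) \<Rightarrow> bool" where
  "leader_motion F v\<^sub>d z u \<longleftrightarrow>
     (\<forall>l. uniformly_bounded (u (Inr l)) \<and>
          uniformly_bounded (vel z (Inr l)) \<and>
          ((\<lambda>t. F (Inr l) (pos z (Inr l) t) (vel z (Inr l) t) (u (Inr l) t)) \<longlongrightarrow> 0) at_top \<and>
          (vel z (Inr l) \<longlongrightarrow> v\<^sub>d) at_top)"

definition formation_error ::
  "('f::finite + 'l::finite) network \<Rightarrow> ('f, 'l, 'd::finite) trajectory
     \<Rightarrow> real \<Rightarrow> real^('f \<times> 'd)" where
  "formation_error G z t =
     stack (\<lambda>i. pos z (Inl i) t)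
     + kronecker (matrix_inv (laplacian1 G) ** laplacian2 G) (mat 1 :: real^'d^'d)
         *v stack (\<lambda>l. pos z (Inr l) t)"

end

theory Submission
  imports Defs
begin

text \<open>
  A first-order filter \<open>y' = - a (y - h)\<close> does not amplify its input: bounds and
  asymptotic bounds for \<open>h\<close> carry over to \<open>y\<close>, up to the contribution of the initial value.
  Hence each follower's estimation error is dominated by a cascade of such filters fed with the
  weighted mean of the delayed errors of its neighbours, plus bounded or vanishing disturbances.
  Since every follower is reached from a leader, a maximum principle holds, so
  \<open>L\<^sub>1\<close> is invertible with monotone inverse, and there are weights
  \<open>\<xi> \<ge> 1\<close> on the followers, extended by 0 to the leaders, whose weighted mean over the
  neighbours of each follower is \<open>\<xi> - 1\<close>.  For the maximum norm weighted by
  \<open>\<xi>\<close> the network is a contraction, whatever the bounded delays are.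

  This is applied first to the velocity estimation errors \<open>vhat - v\<^sub>d\<close>, and then to the
  positions relative to the containment targets \<open>- L\<^sub>1\<^sup>-\<^sup>1 L\<^sub>2 p\<^sub>L\<close>.  In
  the second application boundedness comes first; it makes the reference velocities and their
  derivatives bounded, whence the tracking errors vanish, and convergence follows.
\<close>

section \<open>Solutions of differential equations\<close>

lemma uniformly_bounded_iff:
  "uniformly_bounded x \<longleftrightarrow> (\<exists>B. \<forall>t\<ge>0. norm (x t) \<le> B)"
  by (auto simp: uniformly_bounded_def bounded_iff)

lemma uniformly_boundedI:
  "(\<And>t. t \<ge> 0 \<Longrightarrow> norm (x t) \<le> B) \<Longrightarrow> uniformly_bounded x"
  by (auto simp: uniformly_bounded_iff)

lemma uniformly_bounded_cong:
  assumes "uniformly_bounded x" "\<And>t. t \<ge> 0 \<Longrightarrow> y t = x t"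
  shows "uniformly_bounded y"
  using assms by (auto simp: uniformly_bounded_iff)

lemma uniformly_bounded_const: "uniformly_bounded (\<lambda>t. c)"
  by (auto simp: uniformly_bounded_iff)

lemma uniformly_bounded_add:
  assumes "uniformly_bounded x" "uniformly_bounded y"
  shows "uniformly_bounded (\<lambda>t. x t + y t)"
proof -
  from assms obtain A B where "\<And>t. t \<ge> 0 \<Longrightarrow> norm (x t) \<le> A" "\<And>t. t \<ge> 0 \<Longrightarrow> norm (y t) \<le> B"
    by (auto simp: uniformly_bounded_iff)
  then show ?thesis
    by (intro uniformly_boundedI[of _ "A + B"]) (meson norm_triangle_mono)
qed

lemma uniformly_bounded_scaleR:
  assumes "uniformly_bounded x"
  shows "uniformly_bounded (\<lambda>t. c *\<^sub>R x t)"
proof -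
  from assms obtain A where "\<And>t. t \<ge> 0 \<Longrightarrow> norm (x t) \<le> A"
    by (auto simp: uniformly_bounded_iff)
  then show ?thesis
    by (intro uniformly_boundedI[of _ "\<bar>c\<bar> * A"]) (simp add: mult_left_mono)
qed

lemma uniformly_bounded_diff:
  assumes "uniformly_bounded x" "uniformly_bounded y"
  shows "uniformly_bounded (\<lambda>t. x t - y t)"
  using uniformly_bounded_add[OF assms(1) uniformly_bounded_scaleR[OF assms(2), of "-1"]] by simp

lemma uniformly_bounded_sum:
  assumes "\<And>i. i \<in> I \<Longrightarrow> uniformly_bounded (x i)"
  shows "uniformly_bounded (\<lambda>t. \<Sum>i\<in>I. x i t)"
  using assms
  by (induction I rule: infinite_finite_induct)
    (auto intro: uniformly_bounded_add uniformly_bounded_const)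

lemma bounded_stack:
  fixes g :: "'i::finite \<Rightarrow> real \<Rightarrow> real^'d::finite"
  assumes "\<And>i. uniformly_bounded (g i)"
  shows "uniformly_bounded (\<lambda>t. stack (\<lambda>i. g i t))"
proof -
  obtain B where B: "\<And>i t. t \<ge> 0 \<Longrightarrow> norm (g i t) \<le> B i"
    using assms unfolding uniformly_bounded_iff by metis
  have "norm (stack (\<lambda>i. g i t)) \<le> (\<Sum>(r :: 'i \<times> 'd)\<in>UNIV. B (fst r))" if "t \<ge> 0" for t
  proof -
    have "\<bar>stack (\<lambda>i. g i t) $ r\<bar> \<le> B (fst r)" for r
      using order_trans[OF component_le_norm_cart B[OF that]] by (simp add: stack_def)
    then show ?thesis by (intro order_trans[OF norm_le_l1_cart sum_mono])
  qed
  then show ?thesis by (rule uniformly_boundedI)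
qed

section \<open>Calculus of Caratheodory solutions\<close>

lemma caratheodoryD:
  assumes "caratheodory x f" "t \<ge> 0"
  shows "f absolutely_integrable_on {0..t}" "f integrable_on {0..t}"
    and "x t = x 0 + integral {0..t} f"
  using assms set_lebesgue_integral_eq_integral(1) unfolding caratheodory_def by blast+

lemma caratheodory_continuous_on:
  assumes "caratheodory x f"
  shows "continuous_on {0..} x"
proof -
  have cont: "continuous_on {0..T} x" if "T \<ge> 0" for T
  proof -
    have "continuous_on {0..T} (\<lambda>t. x 0 + integral {0..t} f)"
      by (intro continuous_intros indefinite_integral_continuous_1 caratheodoryD[OF assms that])
    then show ?thesis
    proof (rule continuous_on_eq)
      show "x 0 + integral {0..t} f = x t" if "t \<in> {0..T}" for t
        using caratheodoryD(3)[OF assms, of t] that by (simp only: atLeastAtMost_iff)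
    qed
  qed
  show ?thesis
    unfolding continuous_on_eq_continuous_within
  proof
    fix t :: real assume "t \<in> {0..}"
    then have "continuous (at t within {0..t+1}) x"
      using cont[of "t+1"] by (auto simp: continuous_on_eq_continuous_within)
    moreover have "at t within {0..t+1} = at t within {0..}"
      by (rule at_within_nhd[of t "{..<t+1}"]) auto
    ultimately show "continuous (at t within {0..}) x" by simp
  qed
qed

lemma caratheodory_has_integral:
  assumes "caratheodory x f" "0 \<le> s" "s \<le> t"
  shows "(f has_integral (x t - x s)) {s..t}"
proof -
  have int: "f integrable_on {0..t}"
    by (rule caratheodoryD(2)[OF assms(1)]) (use assms in auto)
  then have "integral {0..s} f + integral {s..t} f = integral {0..t} f"
    using assms(2,3) by (intro Henstock_Kurzweil_Integration.integral_combine) auto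
  then have "x t - x s = integral {s..t} f"
    unfolding caratheodoryD(3)[OF assms(1,2)] caratheodoryD(3)[OF assms(1) order_trans[OF assms(2,3)]]
    by (simp add: algebra_simps)
  moreover have "f integrable_on {s..t}"
    by (rule integrable_on_subinterval[OF int]) (use assms in auto)
  ultimately show ?thesis
    by (simp add: integrable_integral)
qed

text \<open>For continuous right-hand sides the integral equation becomes a classical one, with a
  one-sided derivative at 0. This serves to differentiate the reference velocities.\<close>

lemma caratheodory_has_vector_derivative:
  assumes "caratheodory x f" "continuous_on {0..} f" "t \<ge> 0"
  shows "(x has_vector_derivative f t) (at t within {0..})"
proof -
  have "continuous_on {0..t+1} f" by (rule continuous_on_subset[OF assms(2)]) auto
  then have "((\<lambda>u. integral {0..u} f) has_vector_derivative f t) (at t within {0..t+1})"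
    by (rule integral_has_vector_derivative) (use assms in auto)
  then have "((\<lambda>u. x 0 + integral {0..u} f) has_vector_derivative f t) (at t within {0..t+1})"
    by (auto intro!: derivative_eq_intros)
  then have "(x has_vector_derivative f t) (at t within {0..t+1})"
  proof (rule has_vector_derivative_transform[rotated 2])
    show "x u = x 0 + integral {0..u} f" if "u \<in> {0..t+1}" for u
      using caratheodoryD(3)[OF assms(1), of u] that by (simp only: atLeastAtMost_iff)
  qed (use assms in auto)
  moreover have "at t within {0..t+1} = at t within {0..}"
    by (rule at_within_nhd[of t "{..<t+1}"]) auto
  ultimately show ?thesis by simp
qed

lemma caratheodory_diff:
  assumes "caratheodory x f" "caratheodory y g"
  shows "caratheodory (\<lambda>t. x t - y t) (\<lambda>t. f t - g t)"
  unfolding caratheodory_def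
proof (intro allI impI conjI)
  fix t :: real assume "t \<ge> 0"
  then have fg: "f absolutely_integrable_on {0..t}" "g absolutely_integrable_on {0..t}"
    "x t = x 0 + integral {0..t} f" "y t = y 0 + integral {0..t} g"
    using caratheodoryD assms by blast+
  show "(\<lambda>t. f t - g t) absolutely_integrable_on {0..t}"
    using fg by (intro set_integral_diff) auto
  show "x t - y t = x 0 - y 0 + integral {0..t} (\<lambda>t. f t - g t)"
    unfolding fg(3,4) using fg(1,2)
    by (simp add: integral_diff set_lebesgue_integral_eq_integral(1))
qed

lemma caratheodory_scaleR:
  assumes "caratheodory x f"
  shows "caratheodory (\<lambda>t. c *\<^sub>R x t) (\<lambda>t. c *\<^sub>R f t)"
  unfolding caratheodory_def
proof (intro allI impI conjI)
  fix t :: real assume "t \<ge> 0"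
  then have f: "f absolutely_integrable_on {0..t}" "x t = x 0 + integral {0..t} f"
    using caratheodoryD assms by blast+
  show "(\<lambda>t. c *\<^sub>R f t) absolutely_integrable_on {0..t}"
    using f by (intro absolutely_integrable_scaleR_left) auto
  show "c *\<^sub>R x t = c *\<^sub>R x 0 + integral {0..t} (\<lambda>t. c *\<^sub>R f t)"
    unfolding f(2) by (simp add: scaleR_add_right)
qed

lemma caratheodory_const: "caratheodory (\<lambda>t. c) (\<lambda>t. 0)"
  by (simp add: caratheodory_def)

lemma caratheodory_add:
  assumes "caratheodory x f" "caratheodory y g"
  shows "caratheodory (\<lambda>t. x t + y t) (\<lambda>t. f t + g t)"
  using caratheodory_diff[OF assms(1) caratheodory_scaleR[OF assms(2), of "-1"]] by simp

lemma caratheodory_sum: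
  assumes "\<And>i. i \<in> I \<Longrightarrow> caratheodory (x i) (f i)"
  shows "caratheodory (\<lambda>t. \<Sum>i\<in>I. x i t) (\<lambda>t. \<Sum>i\<in>I. f i t)"
  using assms
  by (induction I rule: infinite_finite_induct)
    (auto intro: caratheodory_add caratheodory_const)

text \<open>Compare with the last point at which \<open>\<delta>\<close> is nonpositive: from there
  on \<open>\<delta>\<close> is nonnegative, so \<open>step\<close> applies. This replaces a
  differential inequality, so \<open>\<delta>\<close> need not be differentiable.\<close>

lemma nonpos_if_nonincreasing_where_nonneg:
  fixes \<delta> :: "real \<Rightarrow> real"
  assumes cont: "continuous_on {a..b} \<delta>" and "a \<le> b" and "\<delta> a \<le> 0"
    and step: "\<And>s. s \<in> {a..b} \<Longrightarrow> \<forall>r\<in>{s..b}. 0 \<le> \<delta> r \<Longrightarrow> \<delta> b \<le> \<delta> s"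
  shows "\<delta> b \<le> 0"
proof (rule ccontr)
  assume pos: "\<not> \<delta> b \<le> 0"
  define Z where "Z = {a..b} \<inter> \<delta> -` {..0}"
  have "closed Z" unfolding Z_def
    by (rule continuous_closed_preimage[OF cont]) auto
  then have "compact Z"
    by (metis Z_def compact_Int_closed compact_Icc inf.left_idem)
  moreover have "a \<in> Z" using assms by (auto simp: Z_def)
  ultimately obtain s where s: "s \<in> Z" "\<And>r. r \<in> Z \<Longrightarrow> r \<le> s"
    using compact_attains_sup[of Z] by blast
  have sab: "s \<in> {a..b}" and s0: "\<delta> s \<le> 0" using s by (auto simp: Z_def)
  have "continuous_on {s..b} \<delta>" by (rule continuous_on_subset[OF cont]) (use sab in auto)
  \<comment> \<open>\<open>step\<close> asks for nonnegativity at \<open>s\<close> itself. A zero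
    right of \<open>s\<close> lies in \<open>Z\<close> and so coincides with its maximum
    \<open>s\<close>, whence \<open>\<delta> s = 0\<close>.\<close>
  then obtain r where r: "s \<le> r" "r \<le> b" "\<delta> r = 0"
    using IVT'[of \<delta> s 0 b] s0 pos sab by auto
  then have "r \<in> Z" using sab by (auto simp: Z_def)
  with s(2) r have "r = s" by fastforce
  have "\<delta> q \<ge> 0" if "q \<in> {s..b}" for q
    using that s(2)[of q] sab r \<open>r = s\<close> by (cases "\<delta> q \<ge> 0") (auto simp: Z_def)
  with step[OF sab] r \<open>r = s\<close> pos show False by auto
qed

text \<open>A scalar comparison along a fixed direction: as long as the component of
  \<open>y\<close> exceeds \<open>\<phi>\<close>, the equation makes it grow no faster than
  \<open>\<phi>\<close>. Only integrals are compared, so a discontinuous \<open>h\<close> is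
  allowed.\<close>

lemma low_pass_bound:
  fixes y h :: "real \<Rightarrow> 'a::euclidean_space"
  assumes ode: "caratheodory y f" and f: "\<And>t. t \<ge> 0 \<Longrightarrow> f t = - a *\<^sub>R (y t - h t)"
    and a: "a > 0" and t: "0 \<le> t0" "t0 \<le> t"
    and h: "\<And>s. s \<in> {t0..t} \<Longrightarrow> norm (h s) \<le> B"
  shows "norm (y t) \<le> norm (y t0) * exp (- a * (t - t0)) + B"
proof -
  \<comment> \<open>The direction is frozen at the final time, which avoids differentiating the
    norm; if \<open>y t = 0\<close>, then \<open>b = 0\<close> does no harm.\<close>
  define b where "b = sgn (y t)"
  define N where "N = norm (y t0)"
  \<comment> \<open>The solution of \<open>\<phi>' = - a (\<phi> - B)\<close> with initial value
    \<open>N + B\<close>.\<close>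
  define \<phi> where "\<phi> s = N * exp (- a * (s - t0)) + B" for s
  have b: "norm b \<le> 1" by (simp add: b_def norm_sgn)
  have bn: "b \<bullet> w \<le> norm w" for w
    using norm_cauchy_schwarz[of b w] mult_right_mono[OF b norm_ge_zero[of w]] by simp
  have B: "B \<ge> 0" using h[of t] t by (meson atLeastAtMost_iff norm_ge_zero order.refl order_trans)
  have by_eq: "b \<bullet> y t = norm (y t)"
    by (cases "y t = 0") (simp_all add: b_def sgn_div_norm dot_square_norm power2_eq_square)
  have "b \<bullet> y t - \<phi> t \<le> 0"
  proof (rule nonpos_if_nonincreasing_where_nonneg[of t0 t "\<lambda>s. b \<bullet> y s - \<phi> s"])
    have "continuous_on {t0..t} y"
      by (rule continuous_on_subset[OF caratheodory_continuous_on[OF ode]]) (use t in auto)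
    then show "continuous_on {t0..t} (\<lambda>s. b \<bullet> y s - \<phi> s)"
      unfolding \<phi>_def by (intro continuous_intros)
    show "b \<bullet> y t0 - \<phi> t0 \<le> 0"
      using bn[of "y t0"] B by (simp add: \<phi>_def N_def)
    fix s assume s: "s \<in> {t0..t}" and nn: "\<forall>r\<in>{s..t}. 0 \<le> b \<bullet> y r - \<phi> r"
    have "(f has_integral (y t - y s)) {s..t}"
      by (rule caratheodory_has_integral[OF ode]) (use s t in auto)
    from has_integral_linear[OF this bounded_linear_inner_right[of b]]
    have 1: "((\<lambda>r. b \<bullet> f r) has_integral (b \<bullet> (y t - y s))) {s..t}" by (simp add: o_def)
    have 2: "((\<lambda>r. - a * (N * exp (- a * (r - t0)))) has_integral (\<phi> t - \<phi> s)) {s..t}"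
      by (rule fundamental_theorem_of_calculus)
        (use s in \<open>auto simp: \<phi>_def has_real_derivative_iff_has_vector_derivative[symmetric]
          intro!: derivative_eq_intros\<close>)
    have "b \<bullet> (y t - y s) \<le> \<phi> t - \<phi> s"
    proof (rule has_integral_le[OF 1 2])
      fix r assume r: "r \<in> {s..t}"
      have "b \<bullet> f r = - a * (b \<bullet> y r - b \<bullet> h r)"
        using f[of r] r s t by (simp add: inner_diff_right)
      moreover have "b \<bullet> h r \<le> B" using bn[of "h r"] h[of r] r s by auto
      moreover have "b \<bullet> y r \<ge> \<phi> r" using nn r by auto
      ultimately have "b \<bullet> f r \<le> - a * (\<phi> r - B)"
        using a by (smt (verit, best) mult_left_mono mult_minus_left)
      then show "b \<bullet> f r \<le> - a * (N * exp (- a * (r - t0)))" by (simp add: \<phi>_def)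
    qed
    then show "b \<bullet> y t - \<phi> t \<le> b \<bullet> y s - \<phi> s" by (simp add: inner_diff_right)
  qed (use t in auto)
  then show ?thesis by (simp add: by_eq \<phi>_def N_def)
qed


section \<open>Signals of gain at most one\<close>

text \<open>The constant \<open>C\<close> is chosen before \<open>T\<close> and \<open>B\<close>, so
  the estimate can be used on every finite horizon before boundedness is known.\<close>

definition bounded_gain ::
  "(real \<Rightarrow> 'a::real_normed_vector) \<Rightarrow> (real \<Rightarrow> 'b::real_normed_vector) \<Rightarrow> bool" where
  "bounded_gain g x \<longleftrightarrow>
     (\<exists>C. \<forall>T B. (\<forall>t\<in>{0..T}. norm (g t) \<le> B) \<longrightarrow> (\<forall>t\<in>{0..T}. norm (x t) \<le> B + C))"

text \<open>For eventually bounded \<open>g\<close> this says that the limit superior of the norm of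
  \<open>x\<close> is at most that of \<open>g\<close>.\<close>

definition limit_gain ::
  "(real \<Rightarrow> 'a::real_normed_vector) \<Rightarrow> (real \<Rightarrow> 'b::real_normed_vector) \<Rightarrow> bool" where
  "limit_gain g x \<longleftrightarrow>
     (\<forall>B. \<forall>\<epsilon>>0. (\<forall>\<^sub>F t in at_top. norm (g t) \<le> B) \<longrightarrow> (\<forall>\<^sub>F t in at_top. norm (x t) \<le> B + \<epsilon>))"

lemma bounded_gain_trans:
  assumes "bounded_gain f g" "bounded_gain g h"
  shows "bounded_gain f h"
proof -
  obtain C D where "\<And>T B. \<forall>t\<in>{0..T}. norm (f t) \<le> B \<Longrightarrow> \<forall>t\<in>{0..T}. norm (g t) \<le> B + C"
    "\<And>T B. \<forall>t\<in>{0..T}. norm (g t) \<le> B \<Longrightarrow> \<forall>t\<in>{0..T}. norm (h t) \<le> B + D"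
    using assms unfolding bounded_gain_def by metis
  then have "\<forall>t\<in>{0..T}. norm (f t) \<le> B \<Longrightarrow> \<forall>t\<in>{0..T}. norm (h t) \<le> B + (C + D)" for T B
    unfolding add.assoc[symmetric] by blast
  then show ?thesis unfolding bounded_gain_def by blast
qed

lemma limit_gain_trans:
  assumes "limit_gain f g" "limit_gain g h"
  shows "limit_gain f h"
  unfolding limit_gain_def
proof (intro allI impI)
  fix B \<epsilon> :: real assume e: "\<epsilon> > 0" and "\<forall>\<^sub>F t in at_top. norm (f t) \<le> B"
  then have "\<forall>\<^sub>F t in at_top. norm (g t) \<le> B + \<epsilon>/2"
    using assms(1) half_gt_zero[OF e] unfolding limit_gain_def by blast
  then have "\<forall>\<^sub>F t in at_top. norm (h t) \<le> B + \<epsilon>/2 + \<epsilon>/2"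
    using assms(2) half_gt_zero[OF e] unfolding limit_gain_def by blast
  then show "\<forall>\<^sub>F t in at_top. norm (h t) \<le> B + \<epsilon>" by (simp add: add.assoc)
qed

text \<open>Bounded disturbances disappear in the constant \<open>C\<close>; in
  \<open>limit_gain_perturb\<close>, vanishing ones disappear in \<open>\<epsilon>\<close>.\<close>

lemma bounded_gain_perturb:
  assumes "uniformly_bounded d" "\<And>t. t \<ge> 0 \<Longrightarrow> x t = g t + d t"
  shows "bounded_gain g x"
proof -
  obtain C where C: "\<And>t. t \<ge> 0 \<Longrightarrow> norm (d t) \<le> C"
    using assms by (auto simp: uniformly_bounded_iff)
  show ?thesis unfolding bounded_gain_def
    by (rule exI[of _ C]) (use C assms(2) in \<open>auto intro!: norm_triangle_mono\<close>)
qed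

lemma limit_gain_perturb:
  assumes "(d \<longlongrightarrow> 0) at_top" "\<And>t. t \<ge> 0 \<Longrightarrow> x t = g t + d t"
  shows "limit_gain g x"
  unfolding limit_gain_def
proof (intro allI impI)
  fix B \<epsilon> :: real assume e: "\<epsilon> > 0" and g: "\<forall>\<^sub>F t in at_top. norm (g t) \<le> B"
  have d: "\<forall>\<^sub>F t in at_top. norm (d t) < \<epsilon>"
    using assms(1) e by (auto simp: tendsto_iff)
  show "\<forall>\<^sub>F t in at_top. norm (x t) \<le> B + \<epsilon>"
    using g d eventually_ge_at_top[of 0]
  proof eventually_elim
    case (elim t)
    then show ?case using assms(2)[of t] norm_triangle_ineq[of "g t" "d t"] by simp
  qed
qed

lemma uniformly_bounded_gain:
  assumes "bounded_gain g x" "uniformly_bounded g"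
  shows "uniformly_bounded x"
proof -
  obtain B where "\<And>t. t \<ge> 0 \<Longrightarrow> norm (g t) \<le> B"
    using assms by (auto simp: uniformly_bounded_iff)
  moreover obtain C where
    "\<And>T B. \<forall>t\<in>{0..T}. norm (g t) \<le> B \<Longrightarrow> \<forall>t\<in>{0..T}. norm (x t) \<le> B + C"
    using assms unfolding bounded_gain_def by metis
  ultimately have "norm (x t) \<le> B + C" if "t \<ge> 0" for t
    using that by (metis atLeastAtMost_iff order.refl)
  then show ?thesis by (rule uniformly_boundedI)
qed

lemma tendsto_zero_gain:
  assumes "limit_gain g x" "(g \<longlongrightarrow> 0) at_top"
  shows "(x \<longlongrightarrow> 0) at_top"
  unfolding tendsto_iff
proof (intro allI impI)
  fix e :: real assume e: "e > 0"
  have "\<forall>\<^sub>F t in at_top. norm (g t) \<le> e/3"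
    using assms(2) e unfolding tendsto_iff
    by (auto dest!: spec[of _ "e/3"] elim!: eventually_mono)
  then have "\<forall>\<^sub>F t in at_top. norm (x t) \<le> e/3 + e/3"
    using assms(1) e unfolding limit_gain_def by (metis divide_pos_pos zero_less_numeral)
  then show "\<forall>\<^sub>F t in at_top. dist (x t) 0 < e"
    by eventually_elim (use e in auto)
qed

lemma low_pass_gain:
  fixes y h :: "real \<Rightarrow> 'a::euclidean_space"
  assumes ode: "caratheodory y f" and f: "\<And>t. t \<ge> 0 \<Longrightarrow> f t = - a *\<^sub>R (y t - h t)" and a: "a > 0"
  shows "bounded_gain h y" "limit_gain h y"
proof -
  show "bounded_gain h y" unfolding bounded_gain_def
  proof (intro exI[of _ "norm (y 0)"] allI impI ballI)
    fix T B t :: real assume h: "\<forall>t\<in>{0..T}. norm (h t) \<le> B" and t: "t \<in> {0..T}"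
    have "norm (y t) \<le> norm (y 0) * exp (- a * (t - 0)) + B"
      by (rule low_pass_bound[OF ode f a]) (use h t in auto)
    also have "norm (y 0) * exp (- a * (t - 0)) \<le> norm (y 0) * 1"
      by (rule mult_left_mono) (use a t in auto)
    finally show "norm (y t) \<le> B + norm (y 0)" by simp
  qed
  show "limit_gain h y" unfolding limit_gain_def
  proof (intro allI impI)
    fix B \<epsilon> :: real assume e: "\<epsilon> > 0" and "\<forall>\<^sub>F t in at_top. norm (h t) \<le> B"
    then obtain t1 where t1: "\<And>t. t \<ge> t1 \<Longrightarrow> norm (h t) \<le> B"
      by (auto simp: eventually_at_top_linorder)
    \<comment> \<open>The bound is restarted at a time from which the input obeys \<open>B\<close>;
      the contribution of \<open>y t0\<close> then decays exponentially.\<close>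
    define t0 where "t0 = max t1 0"
    have "filterlim (\<lambda>t. - a * (- t0 + t)) at_bot at_top"
      by (rule filterlim_tendsto_neg_mult_at_bot[OF tendsto_const _
          filterlim_tendsto_add_at_top[OF tendsto_const filterlim_ident]]) (use a in simp)
    from tendsto_mult_right_zero[OF filterlim_compose[OF exp_at_bot this], of "norm (y t0)"]
    have "((\<lambda>t. norm (y t0) * exp (- a * (t - t0))) \<longlongrightarrow> 0) at_top"
      by (simp add: algebra_simps)
    then have "\<forall>\<^sub>F t in at_top. norm (y t0) * exp (- a * (t - t0)) < \<epsilon>"
      using e by (rule order_tendstoD)
    then show "\<forall>\<^sub>F t in at_top. norm (y t) \<le> B + \<epsilon>"
      using eventually_ge_at_top[of t0]
    proof eventually_elim
      case (elim t)
      have "norm (y t) \<le> norm (y t0) * exp (- a * (t - t0)) + B"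
        by (rule low_pass_bound[OF ode f a]) (use t1 elim in \<open>auto simp: t0_def\<close>)
      then show ?case using elim by simp
    qed
  qed
qed

section \<open>A weighted small-gain argument for delayed interconnections\<close>

locale delayed_interconnection =
  fixes P :: "'i::finite \<Rightarrow> 'i \<Rightarrow> real" and \<xi> :: "'i \<Rightarrow> real"
    and s :: "'i \<Rightarrow> 'i \<Rightarrow> real \<Rightarrow> real" and x :: "'i \<Rightarrow> real \<Rightarrow> 'a::real_normed_vector"
  assumes P_nonneg: "P i j \<ge> 0" and \<xi>_ge_1: "\<xi> i \<ge> 1"
    and P_\<xi>: "(\<Sum>j\<in>UNIV. P i j * \<xi> j) \<le> \<xi> i - 1"
    and s_range: "P i j > 0 \<Longrightarrow> t \<ge> 0 \<Longrightarrow> 0 \<le> s i j t \<and> s i j t \<le> t"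
begin

definition input :: "'i \<Rightarrow> real \<Rightarrow> 'a" where
  "input i t = (\<Sum>j\<in>UNIV. P i j *\<^sub>R x j (s i j t))"

text \<open>The margin 1 in \<open>P_\<xi>\<close> is the source of contraction: passing through the
  network lowers the bound \<open>M * \<xi> i\<close> by \<open>M\<close>.\<close>

lemma norm_input_le:
  assumes "\<And>j. P i j > 0 \<Longrightarrow> norm (x j (s i j t)) \<le> M * \<xi> j" "M \<ge> 0"
  shows "norm (input i t) \<le> M * (\<xi> i - 1)"
proof -
  have "norm (input i t) \<le> (\<Sum>j\<in>UNIV. P i j * (M * \<xi> j))"
    unfolding input_def
  proof (rule sum_norm_le)
    fix j
    show "norm (P i j *\<^sub>R x j (s i j t)) \<le> P i j * (M * \<xi> j)"
      using assms(1)[of j] P_nonneg[of i j] by (cases "P i j = 0") (auto intro: mult_left_mono)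
  qed
  also have "\<dots> = M * (\<Sum>j\<in>UNIV. P i j * \<xi> j)"
    by (simp add: sum_distrib_left algebra_simps)
  also have "\<dots> \<le> M * (\<xi> i - 1)" by (rule mult_left_mono[OF P_\<xi> assms(2)])
  finally show ?thesis .
qed

text \<open>On a horizon \<open>{0..T}\<close> take the agent \<open>k\<close> and time at which the
  weighted norm is largest. Delayed times stay in the horizon, so the gain estimate at this maximum
  bounds it by \<open>C k\<close>, independently of \<open>T\<close>.\<close>

lemma bounded:
  assumes cont: "\<And>i. continuous_on {0..} (x i)" and gain: "\<And>i. bounded_gain (input i) (x i)"
  shows "uniformly_bounded (x i)"
proof -
  obtain C where C: "\<And>i T B. \<forall>t\<in>{0..T}. norm (input i t) \<le> B \<Longrightarrow>
      \<forall>t\<in>{0..T}. norm (x i t) \<le> B + C i"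
    using gain unfolding bounded_gain_def by metis
  have "norm (x i T) \<le> \<xi> i * (\<Sum>k\<in>UNIV. \<bar>C k\<bar>)" if T: "T \<ge> 0" for T
  proof -
    have "\<exists>q\<in>{0..T}. \<forall>t\<in>{0..T}. norm (x j t) / \<xi> j \<le> norm (x j q) / \<xi> j" for j
    proof (rule continuous_attains_sup)
      have "continuous_on {0..T} (x j)" by (rule continuous_on_subset[OF cont]) auto
      moreover have "\<xi> j \<noteq> 0" using \<xi>_ge_1[of j] by auto
      ultimately show "continuous_on {0..T} (\<lambda>t. norm (x j t) / \<xi> j)"
        by (intro continuous_intros) auto
    qed (use T in auto)
    then obtain q where q: "\<And>j. q j \<in> {0..T}"
      "\<And>j t. t \<in> {0..T} \<Longrightarrow> norm (x j t) / \<xi> j \<le> norm (x j (q j)) / \<xi> j"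
      by metis
    define m where "m j = norm (x j (q j)) / \<xi> j" for j
    have "Max (range m) \<in> range m" by (rule Max_in) auto
    then obtain k where k: "m k = Max (range m)" by force
    have mk: "m j \<le> m k" for j unfolding k by (rule Max_ge) auto
    have pos: "\<xi> j > 0" for j using \<xi>_ge_1[of j] by linarith
    have le: "norm (x j t) \<le> m k * \<xi> j" if "t \<in> {0..T}" for j t
    proof -
      have "norm (x j t) / \<xi> j \<le> m k" using q(2)[OF that, of j] mk[of j] by (simp add: m_def)
      then show ?thesis using pos[of j] by (simp add: field_simps)
    qed
    have m0: "m k \<ge> 0" using pos[of k] by (simp add: m_def)
    have "\<forall>t\<in>{0..T}. norm (input k t) \<le> m k * (\<xi> k - 1)"
    proof
      fix t assume t: "t \<in> {0..T}"
      show "norm (input k t) \<le> m k * (\<xi> k - 1)"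
      proof (rule norm_input_le[OF le m0])
        fix j assume "P k j > 0"
        from s_range[OF this, of t] t show "s k j t \<in> {0..T}" by auto
      qed
    qed
    from C[OF this] q(1)[of k] have "norm (x k (q k)) \<le> m k * (\<xi> k - 1) + C k" by blast
    moreover have "norm (x k (q k)) = m k * \<xi> k" using pos[of k] by (simp add: m_def)
    \<comment> \<open>The terms \<open>m k * \<xi> k\<close> cancel, and the margin leaves just
      \<open>m k\<close>.\<close>
    ultimately have "m k \<le> C k" by (simp add: algebra_simps)
    also have "\<dots> \<le> \<bar>C k\<bar>" by simp
    also have "\<dots> \<le> (\<Sum>k\<in>UNIV. \<bar>C k\<bar>)" by (rule member_le_sum) auto
    finally have "m k * \<xi> i \<le> (\<Sum>k\<in>UNIV. \<bar>C k\<bar>) * \<xi> i"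
      using pos[of i] by (intro mult_right_mono) auto
    then show ?thesis using le[of T i] T by (simp add: mult.commute)
  qed
  then show ?thesis by (rule uniformly_boundedI)
qed

text \<open>Each passage through the network improves an eventual bound by the factor
  \<open>\<rho> < 1\<close>. Delayed times tend to infinity, so an eventual bound survives the
  delay.\<close>

lemma tendsto_zero:
  assumes s_lim: "\<And>i j. P i j > 0 \<Longrightarrow> filterlim (s i j) at_top at_top"
    and bd: "\<And>i. uniformly_bounded (x i)" and gain: "\<And>i. limit_gain (input i) (x i)"
  shows "(x i \<longlongrightarrow> 0) at_top"
proof -
  obtain B where B: "\<And>i t. t \<ge> 0 \<Longrightarrow> norm (x i t) \<le> B i"
    using bd unfolding uniformly_bounded_iff by metis
  \<comment> \<open>The summand 1 makes \<open>A\<close> positive, so that \<open>M / 2\<close>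
    below is an admissible \<open>\<epsilon>\<close>.\<close>
  define A where "A = 1 + (\<Sum>k\<in>UNIV. \<bar>B k\<bar>)"
  have A: "A > 0" unfolding A_def by (smt (verit) sum_nonneg abs_ge_zero)
  define S where "S = (\<Sum>k\<in>UNIV. \<xi> k)"
  have \<xi>0: "\<xi> k \<ge> 0" for k using \<xi>_ge_1[of k] by linarith
  have S: "\<xi> k \<le> S" for k unfolding S_def by (rule member_le_sum) (use \<xi>0 in auto)
  have S1: "S \<ge> 1" using S[of undefined] \<xi>_ge_1[of undefined] by linarith
  \<comment> \<open>Half of the margin is spent on the \<open>\<epsilon>\<close> of
    \<open>limit_gain\<close>. The other half gives the factor: \<open>\<xi> k \<le> S\<close>
    yields \<open>\<xi> k - 1 / 2 \<le> \<rho> * \<xi> k\<close>.\<close>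
  define \<rho> where "\<rho> = 1 - 1 / (2 * S)"
  have \<rho>: "0 < \<rho>" "\<rho> < 1" using S1 by (auto simp: \<rho>_def field_simps)
  have *: "\<forall>\<^sub>F t in at_top. norm (x k t) \<le> A * \<rho> ^ n * \<xi> k" for n k
  proof (induction n arbitrary: k)
    case 0
    show ?case using eventually_ge_at_top[of 0]
    proof eventually_elim
      case (elim t)
      have "norm (x k t) \<le> \<bar>B k\<bar>" using B[OF elim, of k] by simp
      also have "\<dots> \<le> (\<Sum>k\<in>UNIV. \<bar>B k\<bar>)" by (rule member_le_sum) auto
      also have "\<dots> \<le> A * 1" by (simp add: A_def)
      also have "\<dots> \<le> A * \<xi> k" by (rule mult_left_mono) (use \<xi>_ge_1 A in auto)
      finally show ?case by simp
    qed
  next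
    case (Suc n)
    define M where "M = A * \<rho> ^ n"
    have M: "M > 0" using A \<rho> by (simp add: M_def)
    have "\<forall>\<^sub>F t in at_top. P k j > 0 \<longrightarrow> norm (x j (s k j t)) \<le> M * \<xi> j" for j
      using eventually_compose_filterlim[OF Suc s_lim, of k j] by (cases "P k j > 0") (auto simp: M_def)
    then have "\<forall>\<^sub>F t in at_top. \<forall>j. P k j > 0 \<longrightarrow> norm (x j (s k j t)) \<le> M * \<xi> j"
      by (rule eventually_all_finite)
    then have "\<forall>\<^sub>F t in at_top. norm (input k t) \<le> M * (\<xi> k - 1)"
      by eventually_elim (use M in \<open>auto intro!: norm_input_le\<close>)
    then have "\<forall>\<^sub>F t in at_top. norm (x k t) \<le> M * (\<xi> k - 1) + M / 2"
      using gain[of k] half_gt_zero[OF M] unfolding limit_gain_def by blast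
    moreover have "M * (\<xi> k - 1) + M / 2 \<le> M * (\<rho> * \<xi> k)"
    proof -
      have "\<xi> k - 1 / 2 \<le> \<rho> * \<xi> k" using S[of k] S1 by (simp add: \<rho>_def field_simps)
      from mult_left_mono[OF this, of M] M show ?thesis by (simp add: algebra_simps)
    qed
    ultimately show ?case
      by (auto elim!: eventually_mono simp: M_def algebra_simps)
  qed
  show ?thesis unfolding tendsto_iff
  proof (intro allI impI)
    fix e :: real assume e: "e > 0"
    have "(\<lambda>n. A * \<rho> ^ n * \<xi> i) \<longlonglongrightarrow> A * 0 * \<xi> i"
      using \<rho> by (intro tendsto_intros LIMSEQ_realpow_zero) auto
    then have "\<forall>\<^sub>F n in sequentially. A * \<rho> ^ n * \<xi> i < e"
      using e by (intro order_tendstoD) auto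
    then obtain n where "A * \<rho> ^ n * \<xi> i < e" by (auto simp: eventually_sequentially)
    with *[of i n] show "\<forall>\<^sub>F t in at_top. dist (x i t) 0 < e"
      by (auto elim!: eventually_mono)
  qed
qed

end


section \<open>The graph\<close>

locale leader_follower_graph =
  fixes G :: "('f::finite + 'l::finite) network"
  assumes weighted: "weighted_digraph G" and roles: "leader_follower G"
    and rooted: "leader_rooted G"
begin

text \<open>Each row is a probability distribution on the in-neighbours of \<open>i\<close>, the
  step of a random walk against the edges.\<close>

definition P :: "'f \<Rightarrow> 'f + 'l \<Rightarrow> real" where
  "P i j = weight G $ Inl i $ j / in_weight G i"

lemma weight_nonneg: "weight G $ i $ j \<ge> 0"
  using weighted unfolding weighted_digraph_def by (metis less_eq_real_def)

lemma weight_diag: "weight G $ i $ i = 0"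
  using weighted unfolding weighted_digraph_def by blast

lemma in_weight_pos: "in_weight G i > 0"
proof -
  obtain j where "(j, Inl i) \<in> edges G" using roles unfolding leader_follower_def by blast
  then have "weight G $ Inl i $ j > 0" using weighted unfolding weighted_digraph_def by blast
  then show ?thesis unfolding in_weight_def
    by (intro sum_pos2[of _ j]) (auto simp: weight_nonneg)
qed

lemma P_nonneg: "P i j \<ge> 0"
  using weight_nonneg in_weight_pos[of i] by (simp add: P_def)

lemma P_pos_iff: "P i j > 0 \<longleftrightarrow> (j, Inl i) \<in> edges G"
  using weighted in_weight_pos[of i] unfolding weighted_digraph_def P_def
  by (metis divide_pos_pos div_0 less_irrefl)

lemma sum_P: "(\<Sum>j\<in>UNIV. P i j) = 1"
  using in_weight_pos[of i] by (simp add: P_def in_weight_def flip: sum_divide_distrib)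

lemma weighted_mean_eq: "weighted_mean G i y = (\<Sum>j\<in>UNIV. P i j *\<^sub>R y j)"
  by (simp add: weighted_mean_def P_def scaleR_sum_right)

lemma sum_agents:
  "(\<Sum>j\<in>UNIV. g j) = (\<Sum>j\<in>UNIV. g (Inl j)) + (\<Sum>l\<in>UNIV. g (Inr l))"
  for g :: "'f + 'l \<Rightarrow> 'c::comm_monoid_add"
  using sum.Plus[of UNIV UNIV g] by simp

text \<open>If the maximum were positive, averaging would force every in-neighbour of a maximiser to
  be a maximiser. Going back along a path from a leader gives a leader with a positive
  value.\<close>

lemma maximum_principle:
  fixes u :: "'f + 'l \<Rightarrow> real"
  assumes sub: "\<And>i. u (Inl i) \<le> (\<Sum>j\<in>UNIV. P i j * u j)" and lead: "\<And>l. u (Inr l) \<le> 0"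
  shows "u j \<le> 0"
proof (rule ccontr)
  assume "\<not> u j \<le> 0"
  define M where "M = Max (range u)"
  have le: "u k \<le> M" for k unfolding M_def by (rule Max_ge) auto
  have M: "M > 0" using le[of j] \<open>\<not> u j \<le> 0\<close> by linarith
  have "M \<in> range u" unfolding M_def by (rule Max_in) auto
  then obtain k where k: "u k = M" by force
  have edge: "u a = M" if ab: "(a, b) \<in> edges G" "u b = M" for a b
  proof -
    obtain i where i: "b = Inl i"
      using roles ab(1) by (cases b) (auto simp: leader_follower_def)
    have "(\<Sum>j\<in>UNIV. P i j * (M - u j)) = M - (\<Sum>j\<in>UNIV. P i j * u j)"
      using sum_P[of i] by (simp add: right_diff_distrib sum_subtractf flip: sum_distrib_right)
    also have "\<dots> \<le> 0" using sub[of i] that(2) i by simp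
    finally have "(\<Sum>j\<in>UNIV. P i j * (M - u j)) = 0"
      using le P_nonneg by (intro order.antisym sum_nonneg) (auto intro!: mult_nonneg_nonneg)
    then have "P i a * (M - u a) = 0"
      by (subst (asm) sum_nonneg_eq_0_iff) (use le P_nonneg in auto)
    moreover have "P i a > 0" using P_pos_iff that(1) i by simp
    ultimately show ?thesis by simp
  qed
  have path: "u a = M" if "(a, b) \<in> (edges G)\<^sup>+" "u b = M" for a b
    using that by (induction rule: converse_trancl_induct) (metis edge)+
  obtain i where i: "k = Inl i" using k M lead by (cases k) (auto simp: not_le[symmetric])
  obtain l where "(Inr l, Inl i) \<in> (edges G)\<^sup>+" using rooted by (auto simp: leader_rooted_def)
  then have "u (Inr l) = M" using path k i by blast
  then show False using lead[of l] M by simp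
qed

text \<open>Turns linear systems for \<open>laplacian1 G\<close> into mean-value equations, to which
  the maximum principle applies.\<close>

lemma laplacian1_mult:
  "(laplacian1 G *v x) $ i = in_weight G i * (x $ i - (\<Sum>j\<in>UNIV. P i (Inl j) * x $ j))"
proof -
  have "laplacian1 G $ i $ j * x $ j =
      (if i = j then in_weight G i * x $ i else 0) - weight G $ Inl i $ Inl j * x $ j" for j
    by (auto simp: laplacian1_def laplacian_def in_weight_def weight_diag)
  then have "(laplacian1 G *v x) $ i =
      in_weight G i * x $ i - (\<Sum>j\<in>UNIV. weight G $ Inl i $ Inl j * x $ j)"
    by (simp add: matrix_vector_mult_def sum_subtractf)
  also have "(\<Sum>j\<in>UNIV. weight G $ Inl i $ Inl j * x $ j) =
      in_weight G i * (\<Sum>j\<in>UNIV. P i (Inl j) * x $ j)"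
    using in_weight_pos[of i] by (simp add: sum_distrib_left P_def)
  finally show ?thesis by (simp add: right_diff_distrib)
qed

text \<open>A kernel vector, extended by 0 to the leaders, is its own weighted mean; the maximum
  principle for it and for its negative makes it vanish.\<close>

lemma invertible_laplacian1: "invertible (laplacian1 G)"
  unfolding invertible_left_inverse matrix_left_invertible_ker
proof (intro allI impI)
  fix x assume "laplacian1 G *v x = 0"
  then have ker: "(laplacian1 G *v x) $ i = 0" for i by simp
  have "x $ i = (\<Sum>j\<in>UNIV. P i (Inl j) * x $ j)" for i
    using in_weight_pos[of i] ker[unfolded laplacian1_mult, of i] by auto
  then have eq: "x $ i \<le> (\<Sum>j\<in>UNIV. P i (Inl j) * x $ j)"
      "(\<Sum>j\<in>UNIV. P i (Inl j) * x $ j) \<le> x $ i" for i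
    by (metis order.refl)+
  have "x $ i \<le> 0" for i
    using maximum_principle[of "case_sum (($) x) (\<lambda>_. 0)" "Inl i"] eq
    by (simp add: sum_agents)
  moreover have "- x $ i \<le> 0" for i
    using maximum_principle[of "case_sum (\<lambda>i. - x $ i) (\<lambda>_. 0)" "Inl i"] eq
    by (simp add: sum_agents sum_negf)
  ultimately show "x = 0" by (simp add: vec_eq_iff order.antisym)
qed

lemma laplacian1_inv: "laplacian1 G ** matrix_inv (laplacian1 G) = mat 1"
  using someI_ex[OF invertible_laplacian1[unfolded invertible_def]]
  by (simp add: matrix_inv_def)

text \<open>The expected number of steps after which the random walk \<open>P\<close> hits a leader;
  \<open>\<xi>_eq\<close> is its first-step equation.\<close>

definition \<xi> :: "'f \<Rightarrow> real" where
  "\<xi> i = (matrix_inv (laplacian1 G) *v (\<chi> i. in_weight G i)) $ i"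

lemma \<xi>_eq: "\<xi> i = (\<Sum>j\<in>UNIV. P i (Inl j) * \<xi> j) + 1"
proof -
  have "laplacian1 G *v (\<chi> i. \<xi> i) = (\<chi> i. in_weight G i)"
    using laplacian1_inv by (simp add: \<xi>_def matrix_vector_mul_assoc)
  from arg_cong[OF this, of "\<lambda>v. v $ i"] show ?thesis
    unfolding laplacian1_mult using in_weight_pos[of i] by simp
qed

lemma \<xi>_ge_1: "\<xi> i \<ge> 1"
proof -
  have "(\<Sum>j\<in>UNIV. P i (Inl j) * \<xi> j) \<le> \<xi> i" for i
    using \<xi>_eq[of i] by linarith
  then have nonneg: "0 \<le> \<xi> i" for i
    using maximum_principle[of "case_sum (\<lambda>i. - \<xi> i) (\<lambda>_. 0)" "Inl i"]
    by (simp add: sum_agents sum_negf)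
  have "0 \<le> (\<Sum>j\<in>UNIV. P i (Inl j) * \<xi> j)"
    by (intro sum_nonneg mult_nonneg_nonneg P_nonneg nonneg)
  then show ?thesis using \<xi>_eq[of i] by linarith
qed

text \<open>The containment weights, with the sign of \<open>formation_error\<close> absorbed. As
  functions of \<open>j\<close> they are the harmonic extensions of the indicators of the
  leaders.\<close>

definition target :: "'f + 'l \<Rightarrow> 'l \<Rightarrow> real" where
  "target j l = (case j of
     Inl i \<Rightarrow> - (matrix_inv (laplacian1 G) ** laplacian2 G) $ i $ l
   | Inr k \<Rightarrow> of_bool (k = l))"

text \<open>Column \<open>l\<close> of the identity obtained by multiplying the inverse of
  \<open>laplacian1 G\<close> back, read as a mean-value equation.\<close>

lemma target_mean: "target (Inl i) l = (\<Sum>j\<in>UNIV. P i j * target j l)"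
proof -
  define x where "x = (\<chi> i. (matrix_inv (laplacian1 G) ** laplacian2 G) $ i $ l)"
  have "laplacian1 G *v x = column l (laplacian1 G ** (matrix_inv (laplacian1 G) ** laplacian2 G))"
    by (simp add: vec_eq_iff x_def column_def matrix_vector_mult_def matrix_matrix_mult_def)
  also have "\<dots> = column l (laplacian2 G)"
    by (simp add: matrix_mul_assoc laplacian1_inv)
  finally have "(laplacian1 G *v x) $ i = - weight G $ Inl i $ Inr l"
    by (simp add: column_def laplacian2_def laplacian_def)
  then have "x $ i - (\<Sum>j\<in>UNIV. P i (Inl j) * x $ j) = - P i (Inr l)"
    using in_weight_pos[of i] unfolding laplacian1_mult by (simp add: P_def field_simps)
  moreover have "x $ i = - target (Inl i) l" for i by (simp add: x_def target_def)
  moreover have "(\<Sum>k\<in>UNIV. P i (Inr k) * target (Inr k) l) = P i (Inr l)"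
    by (simp add: target_def of_bool_def if_distrib cong: if_cong)
  ultimately show ?thesis by (simp add: sum_agents sum_negf)
qed

text \<open>The row sums and the constant 1 have the same leader values and both equal their
  weighted means, so the maximum principle applies to both differences. Hence targets inherit the
  leaders' common limit velocity.\<close>

lemma sum_target: "(\<Sum>l\<in>UNIV. target j l) = 1"
proof -
  define r where "r j = (\<Sum>l\<in>UNIV. target j l)" for j
  have lead: "r (Inr l) = 1" for l by (simp add: r_def target_def of_bool_def)
  have mean: "r (Inl i) = (\<Sum>j\<in>UNIV. P i j * r j)" for i
    unfolding r_def target_mean sum_distrib_left by (rule sum.swap)
  have "r j - 1 \<le> 0"
    by (rule maximum_principle)
      (use lead mean sum_P in \<open>auto simp: right_diff_distrib sum_subtractf\<close>)
  moreover have "1 - r j \<le> 0"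
    by (rule maximum_principle)
      (use lead mean sum_P in \<open>auto simp: right_diff_distrib sum_subtractf\<close>)
  ultimately show ?thesis by (simp add: r_def)
qed

end


section \<open>Communication delays\<close>

text \<open>Take the last \<open>l\<close> with \<open>inst G (s l) + D \<le> t\<close>. The next
  packet has arrived by \<open>t\<close> and, by maximality, was sent after \<open>t - D\<close>;
  the newest delivered packet is at least as recent.\<close>

lemma blackout_bound:
  assumes samp: "common_sampling G" and s: "strict_mono s" "range s \<subseteq> samp G i j"
    and e: "(j, i) \<in> edges G"
    and black: "\<And>l. ereal (inst G (s (Suc l))) + delay G i j (s (Suc l)) - ereal (inst G (s l))
                 \<le> ereal D"
    and fin: "finite (delivered G i j t)" and t: "t \<ge> inst G (s 0) + D"
  shows "t - D \<le> last_inst G i j t"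
proof -
  have per: "period G > 0" and inst: "\<And>k. k \<in> samp G i j \<Longrightarrow> inst G k = real k * period G"
    using samp e by (auto simp: common_sampling_def)
  have sk: "s l \<in> samp G i j" for l using s by auto
  define A where "A = {l. inst G (s l) + D \<le> t}"
  have "A \<subseteq> {..nat \<lceil>(t - D) / period G\<rceil>}"
  proof
    fix l assume "l \<in> A"
    then have "real (s l) \<le> (t - D) / period G"
      using per by (simp add: A_def inst[OF sk] field_simps)
    moreover have "l \<le> s l" by (rule strict_mono_imp_increasing[OF s(1)])
    ultimately have "real l \<le> real_of_int \<lceil>(t - D) / period G\<rceil>" by linarith
    then show "l \<in> {..nat \<lceil>(t - D) / period G\<rceil>}" by simp
  qed
  then have finA: "finite A" by (rule finite_subset) auto
  have "0 \<in> A" using t by (simp add: A_def)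
  define l where "l = Max A"
  have "l \<in> A" unfolding l_def by (rule Max_in) (use finA \<open>0 \<in> A\<close> in auto)
  have "Suc l \<notin> A" using Max_ge[OF finA, of "Suc l"] by (auto simp: l_def)
  \<comment> \<open>The blackout bound rules out an infinite delay here.\<close>
  have "ereal (inst G (s (Suc l))) + delay G i j (s (Suc l)) \<le> ereal t"
    using black[of l] \<open>l \<in> A\<close> by (cases "delay G i j (s (Suc l))") (auto simp: A_def)
  then have del: "s (Suc l) \<in> delivered G i j t" using sk by (auto simp: delivered_def)
  then have "s (Suc l) \<le> Max (delivered G i j t)" by (rule Max_ge[OF fin])
  moreover have "Max (delivered G i j t) \<in> samp G i j"
    using Max_in[OF fin] del by (auto simp: delivered_def)
  ultimately have "inst G (s (Suc l)) \<le> inst G (Max (delivered G i j t))"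
    using per by (simp add: inst sk)
  then show ?thesis
    using del \<open>Suc l \<notin> A\<close> by (auto simp: last_inst_def last_index_def A_def)
qed

text \<open>One delay bound for all edges and all times, including the initial phase before the
  first guaranteed delivery.\<close>

lemma last_inst_delay:
  assumes comm: "communication G" and black: "bounded_blackout G" and samp: "common_sampling G"
  obtains D where "D \<ge> 0"
    "\<And>i j t. (j, i) \<in> edges G \<Longrightarrow> t \<ge> 0 \<Longrightarrow>
       0 \<le> last_inst G i j t \<and> last_inst G i j t \<le> t \<and> t - D \<le> last_inst G i j t"
    "\<And>i j t. (j, i) \<in> edges G \<Longrightarrow> real (last_index G i j t) * period G = last_inst G i j t"
proof -
  have per: "period G > 0"
    and inst: "\<And>i j k. (j, i) \<in> edges G \<Longrightarrow> k \<in> samp G i j \<Longrightarrow> inst G k = real k * period G"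
    using samp by (auto simp: common_sampling_def)
  have del: "k \<in> samp G i j \<and> inst G k \<le> t \<and> real k * period G \<le> t"
    if "(j, i) \<in> edges G" "k \<in> delivered G i j t" for i j k t
  proof -
    have k: "k \<in> samp G i j" "ereal (inst G k) + delay G i j k \<le> ereal t"
      using that(2) by (auto simp: delivered_def)
    then have "0 \<le> delay G i j k" using comm that(1) by (auto simp: communication_def)
    then have "ereal (inst G k) \<le> ereal t"
      using k(2) by (metis add.right_neutral add_left_mono order_trans)
    then show ?thesis using k inst[OF that(1)] by simp
  qed
  have fin: "finite (delivered G i j t)" if e: "(j, i) \<in> edges G" for i j t
  proof (rule finite_subset)
    show "delivered G i j t \<subseteq> {..nat \<lceil>t / period G\<rceil>}"
    proof
      fix k assume "k \<in> delivered G i j t"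
      then have "real k \<le> t / period G" using del[OF e] per by (simp add: field_simps)
      then have "real k \<le> real_of_int \<lceil>t / period G\<rceil>" by linarith
      then show "k \<in> {..nat \<lceil>t / period G\<rceil>}" by simp
    qed
  qed auto
  have mx: "Max (delivered G i j t) \<in> delivered G i j t"
    if "(j, i) \<in> edges G" "delivered G i j t \<noteq> {}" for i j t
    by (rule Max_in[OF fin[OF that(1)] that(2)])
  have range: "0 \<le> last_inst G i j t \<and> last_inst G i j t \<le> t" if "(j, i) \<in> edges G" "t \<ge> 0" for i j t
  proof (cases "delivered G i j t = {}")
    case False
    from del[OF that(1) mx[OF that(1) False]] show ?thesis
      using inst[OF that(1), of "Max (delivered G i j t)"] per False
      by (simp add: last_inst_def last_index_def)
  qed (use that in \<open>simp add: last_inst_def\<close>)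
  have idx: "real (last_index G i j t) * period G = last_inst G i j t"
    if "(j, i) \<in> edges G" for i j t
  proof (cases "delivered G i j t = {}")
    case False
    from del[OF that mx[OF that False]] show ?thesis
      using inst[OF that, of "Max (delivered G i j t)"] False
      by (simp add: last_inst_def last_index_def)
  qed (simp add: last_inst_def last_index_def)
  obtain Ts where Ts: "Ts > 0" "\<And>i j. (j, i) \<in> edges G \<Longrightarrow> \<exists>s :: nat \<Rightarrow> nat.
        strict_mono s \<and> range s \<subseteq> samp G i j \<and>
        (\<forall>l. ereal (inst G (s (Suc l))) + delay G i j (s (Suc l)) - ereal (inst G (s l))
               \<le> ereal Ts)"
    using black unfolding bounded_blackout_def by fastforce
  have "\<exists>D. \<forall>t\<ge>0. (j, i) \<in> edges G \<longrightarrow> t - D \<le> last_inst G i j t" for i j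
  proof (cases "(j, i) \<in> edges G")
    case True
    then obtain s where s: "strict_mono s" "range s \<subseteq> samp G i j"
      "\<And>l. ereal (inst G (s (Suc l))) + delay G i j (s (Suc l)) - ereal (inst G (s l)) \<le> ereal Ts"
      using Ts(2) by blast
    have "s 0 \<in> samp G i j" using s(2) by blast
    from inst[OF True this] per have i0: "inst G (s 0) \<ge> 0" by simp
    \<comment> \<open>Adding \<open>inst G (s 0)\<close> covers early times: there the left-hand
      side is negative, while the last instant is nonnegative.\<close>
    have "t - (inst G (s 0) + Ts) \<le> last_inst G i j t" if t: "t \<ge> 0" for t
    proof (cases "t \<ge> inst G (s 0) + Ts")
      case T: True
      from blackout_bound[OF samp s(1,2) True s(3) fin[OF True] T] i0 show ?thesis by linarith
    next
      case False
      then show ?thesis using range[OF True t] by linarith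
    qed
    then show ?thesis by blast
  qed auto
  then have "\<forall>i j. \<exists>D. \<forall>t\<ge>0. (j, i) \<in> edges G \<longrightarrow> t - D \<le> last_inst G i j t"
    by blast
  then obtain D where D: "\<forall>i j. \<forall>t\<ge>0. (j, i) \<in> edges G \<longrightarrow> t - D i j \<le> last_inst G i j t"
    unfolding choice_iff by blast
  define D' where "D' = (\<Sum>i\<in>UNIV. \<Sum>j\<in>UNIV. \<bar>D i j\<bar>)"
  have DD': "\<bar>D i j\<bar> \<le> D'" for i j
  proof -
    have "\<bar>D i j\<bar> \<le> (\<Sum>j\<in>UNIV. \<bar>D i j\<bar>)" by (rule member_le_sum) auto
    also have "\<dots> \<le> D'" unfolding D'_def
      by (rule member_le_sum[where f = "\<lambda>i. \<Sum>j\<in>UNIV. \<bar>D i j\<bar>"]) (auto intro: sum_nonneg)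
    finally show ?thesis .
  qed
  have "t - D' \<le> last_inst G i j t" if "(j, i) \<in> edges G" "t \<ge> 0" for i j t
    using D[rule_format, OF that(2,1)] DD'[of i j] by linarith
  moreover have "D' \<ge> 0" unfolding D'_def by (intro sum_nonneg) auto
  ultimately show ?thesis using that range idx by blast
qed

lemma filterlim_delayed:
  fixes s :: "real \<Rightarrow> real"
  assumes "\<And>t. t \<ge> 0 \<Longrightarrow> t - D \<le> s t"
  shows "filterlim s at_top at_top"
proof (rule filterlim_at_top_mono)
  show "filterlim (\<lambda>t. - D + t) at_top at_top"
    by (rule filterlim_tendsto_add_at_top[OF tendsto_const filterlim_ident])
  show "\<forall>\<^sub>F t in at_top. - D + t \<le> s t"
    using eventually_ge_at_top[of 0] by eventually_elim (use assms in force)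
qed

lemma uniformly_bounded_delayed:
  assumes "uniformly_bounded x" "\<And>t. t \<ge> 0 \<Longrightarrow> 0 \<le> s t"
  shows "uniformly_bounded (\<lambda>t. x (s t))"
  using assms unfolding uniformly_bounded_iff by metis

text \<open>The error is the integral of \<open>r (s t) - q\<close> over the window from
  \<open>s t\<close> to \<open>t\<close>, of length at most \<open>D\<close>. Both velocities are
  compared with their common limit \<open>v\<close>.\<close>

lemma extrapolation_error:
  fixes Q q r :: "real \<Rightarrow> 'a::euclidean_space"
  assumes Q: "caratheodory Q q" and qb: "uniformly_bounded q" and ql: "(q \<longlongrightarrow> v) at_top"
    and rb: "uniformly_bounded r" and rl: "(r \<longlongrightarrow> v) at_top"
    and s: "\<And>t. t \<ge> 0 \<Longrightarrow> 0 \<le> s t \<and> s t \<le> t \<and> t - D \<le> s t"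
  defines "b \<equiv> \<lambda>t. Q (s t) + (t - s t) *\<^sub>R r (s t) - Q t"
  shows "uniformly_bounded b" "(b \<longlongrightarrow> 0) at_top"
proof -
  have D: "D \<ge> 0" using s[of 0] by linarith
  \<comment> \<open>The bounds concern only the window: global bounds give boundedness, small
    eventual bounds give convergence.\<close>
  have key: "norm (b t) \<le> D * (A + B)"
    if t: "t \<ge> 0" and A: "\<And>u. u \<in> {s t..t} \<Longrightarrow> norm (q u - v) \<le> A" and B: "norm (r (s t) - v) \<le> B"
    for t A B
  proof -
    have st: "0 \<le> s t" "s t \<le> t" "t - s t \<le> D" using s[OF t] by auto
    have AB: "A \<ge> 0" "B \<ge> 0" using A[of t] B st norm_ge_zero order_trans by (auto, blast+)
    have "((\<lambda>u. q u - v) has_integral (Q t - Q (s t)) - (t - s t) *\<^sub>R v) {s t..t}"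
      using has_integral_diff[OF caratheodory_has_integral[OF Q st(1,2)]
          has_integral_const_real[of v "s t" t]] st by simp
    from has_integral_bound_real[OF AB(1) finite.emptyI this]
    have "norm (Q t - Q (s t) - (t - s t) *\<^sub>R v) \<le> A * (t - s t)"
      using A st(2) by simp
    also have "\<dots> \<le> A * D" using AB st by (intro mult_left_mono) auto
    finally have 1: "norm (Q t - Q (s t) - (t - s t) *\<^sub>R v) \<le> A * D" .
    have 2: "norm ((t - s t) *\<^sub>R (r (s t) - v)) \<le> D * B"
      using st B AB by (auto intro!: mult_mono)
    have "b t = (t - s t) *\<^sub>R (r (s t) - v) - (Q t - Q (s t) - (t - s t) *\<^sub>R v)"
      by (simp add: b_def algebra_simps)
    then have "norm (b t) \<le> D * B + A * D"
      using norm_triangle_ineq4 1 2 by (metis add_mono order_trans)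
    then show ?thesis by (simp add: algebra_simps)
  qed
  obtain A B where A: "\<And>t. t \<ge> 0 \<Longrightarrow> norm (q t - v) \<le> A" and B: "\<And>t. t \<ge> 0 \<Longrightarrow> norm (r t - v) \<le> B"
    using uniformly_bounded_diff[OF qb uniformly_bounded_const]
      uniformly_bounded_diff[OF rb uniformly_bounded_const]
    unfolding uniformly_bounded_iff by metis
  show "uniformly_bounded b"
  proof (rule uniformly_boundedI)
    fix t :: real assume t: "t \<ge> 0"
    show "norm (b t) \<le> D * (A + B)"
      by (rule key[OF t]) (use A B s[OF t] in auto)
  qed
  show "(b \<longlongrightarrow> 0) at_top" unfolding tendsto_iff
  proof (intro allI impI)
    fix e :: real assume e: "e > 0"
    \<comment> \<open>\<open>D + 1\<close> instead of \<open>D\<close> covers the case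
      \<open>D = 0\<close>.\<close>
    define c where "c = e / (2 * (D + 1))"
    have c0: "c > 0" using e D by (simp add: c_def)
    have "c * (2 * (D + 1)) = e" using D by (simp add: c_def)
    with c0 have c: "c > 0" "D * (c + c) < e" by (auto simp: algebra_simps)
    have "\<forall>\<^sub>F t in at_top. norm (q t - v) < c \<and> norm (r t - v) < c"
      using ql rl c by (auto simp: tendsto_iff dist_norm eventually_conj_iff)
    then obtain t1 where t1: "\<And>t. t \<ge> t1 \<Longrightarrow> norm (q t - v) < c \<and> norm (r t - v) < c"
      by (auto simp: eventually_at_top_linorder)
    show "\<forall>\<^sub>F t in at_top. dist (b t) 0 < e"
      \<comment> \<open>After \<open>t1 + D\<close> the whole window lies beyond
        \<open>t1\<close>.\<close>
      using eventually_ge_at_top[of "max 0 (t1 + D)"]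
    proof eventually_elim
      case (elim t)
      then have t: "t \<ge> 0" "s t \<ge> t1" using s[of t] by auto
      have "norm (b t) \<le> D * (c + c)"
        by (rule key[OF t(1)]) (use t1 t in \<open>auto intro!: less_imp_le\<close>)
      then show ?case using c by simp
    qed
  qed
qed

text \<open>A disturbance \<open>d\<close> of the equation acts as a perturbation
  \<open>d / a\<close> of the filter's input.\<close>

lemma low_pass_perturbed_gain:
  fixes y g d :: "real \<Rightarrow> 'a::euclidean_space"
  assumes ode: "caratheodory y f" and f: "\<And>t. t \<ge> 0 \<Longrightarrow> f t = - a *\<^sub>R (y t - g t) + d t"
    and a: "a > 0"
  shows "uniformly_bounded d \<Longrightarrow> bounded_gain g y"
    and "(d \<longlongrightarrow> 0) at_top \<Longrightarrow> limit_gain g y"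
proof -
  have f': "f t = - a *\<^sub>R (y t - (g t + (1 / a) *\<^sub>R d t))" if "t \<ge> 0" for t
    using f[OF that] a by (simp add: algebra_simps)
  note gain = low_pass_gain[OF ode f' a]
  show "bounded_gain g y" if "uniformly_bounded d"
    by (rule bounded_gain_trans[OF bounded_gain_perturb gain(1)])
      (rule uniformly_bounded_scaleR[OF that], rule refl)
  show "limit_gain g y" if "(d \<longlongrightarrow> 0) at_top"
    by (rule limit_gain_trans[OF limit_gain_perturb gain(2)])
      (rule tendsto_scaleR[OF tendsto_const that, simplified], rule refl)
qed


section \<open>The closed loop\<close>

locale delayed_graph = leader_follower_graph G
  for G :: "('f::finite + 'l::finite) network" +
  fixes D :: real
  assumes delay: "\<And>i j t. P i j > 0 \<Longrightarrow> t \<ge> 0 \<Longrightarrow> 0 \<le> last_inst G (Inl i) j t \<and>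
      last_inst G (Inl i) j t \<le> t \<and> t - D \<le> last_inst G (Inl i) j t"
    and index: "\<And>i j t. P i j > 0 \<Longrightarrow>
      real (last_index G (Inl i) j t) * period G = last_inst G (Inl i) j t"
begin

abbreviation \<tau> :: "'f \<Rightarrow> 'f + 'l \<Rightarrow> real \<Rightarrow> real" where
  "\<tau> i j t \<equiv> last_inst G (Inl i) j t"

lemma bounded_P_sum:
  fixes y :: "'f + 'l \<Rightarrow> real \<Rightarrow> 'a::real_normed_vector"
  assumes "\<And>j. P i j > 0 \<Longrightarrow> uniformly_bounded (y j)"
  shows "uniformly_bounded (\<lambda>t. \<Sum>j\<in>UNIV. P i j *\<^sub>R y j t)"
proof (rule uniformly_bounded_sum)
  show "uniformly_bounded (\<lambda>t. P i j *\<^sub>R y j t)" for j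
    using assms[of j] P_nonneg[of i j]
    by (cases "P i j = 0") (auto intro: uniformly_bounded_scaleR uniformly_bounded_const)
qed

lemma tendsto_P_sum:
  fixes y :: "'f + 'l \<Rightarrow> real \<Rightarrow> 'a::real_normed_vector"
  assumes "\<And>j. P i j > 0 \<Longrightarrow> (y j \<longlongrightarrow> 0) at_top"
  shows "((\<lambda>t. \<Sum>j\<in>UNIV. P i j *\<^sub>R y j t) \<longlongrightarrow> 0) at_top"
proof (rule tendsto_null_sum)
  show "((\<lambda>t. P i j *\<^sub>R y j t) \<longlongrightarrow> 0) at_top" for j
    using assms[of j] P_nonneg[of i j] tendsto_scaleR[OF tendsto_const, of "y j" 0 at_top "P i j"]
    by (cases "P i j = 0") auto
qed

definition mean :: "('f + 'l \<Rightarrow> real \<Rightarrow> 'a::real_normed_vector) \<Rightarrow> 'f \<Rightarrow> real \<Rightarrow> 'a" where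
  "mean x i t = (\<Sum>j\<in>UNIV. P i j *\<^sub>R x j (\<tau> i j t))"

lemma bounded_mean:
  assumes "\<And>j. uniformly_bounded (x j)"
  shows "uniformly_bounded (mean x i)"
  unfolding mean_def
  by (rule bounded_P_sum[where y = "\<lambda>j t. x j (\<tau> i j t)"], rule uniformly_bounded_delayed)
    (use assms delay in auto)

lemma tendsto_delayed:
  assumes "(y \<longlongrightarrow> c) at_top" "P i j > 0"
  shows "((\<lambda>t. y (\<tau> i j t)) \<longlongrightarrow> c) at_top"
  by (rule filterlim_compose[OF assms(1)], rule filterlim_delayed[of D]) (use assms delay in auto)

lemma tendsto_mean:
  assumes "\<And>j. (x j \<longlongrightarrow> 0) at_top"
  shows "(mean x i \<longlongrightarrow> 0) at_top"
  unfolding mean_def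
  by (rule tendsto_P_sum[where y = "\<lambda>j t. x j (\<tau> i j t)"], rule tendsto_delayed[OF assms])

text \<open>Only the follower block of \<open>P\<close> enters; as \<open>\<xi>\<close> is extended
  by 0 to the leaders, the margin 1 is kept.\<close>

lemma interconnection:
  "delayed_interconnection (\<lambda>i j. P i (Inl j)) \<xi> (\<lambda>i j. \<tau> i (Inl j))"
proof
  show "(\<Sum>j\<in>UNIV. P i (Inl j) * \<xi> j) \<le> \<xi> i - 1" for i using \<xi>_eq[of i] by linarith
qed (use P_nonneg \<xi>_ge_1 delay in auto)

context
  fixes x :: "'f + 'l \<Rightarrow> real \<Rightarrow> 'a::real_normed_vector"
  assumes leaders: "\<And>l. uniformly_bounded (x (Inr l))"
begin

interpretation I: delayed_interconnection "\<lambda>i j. P i (Inl j)" \<xi> "\<lambda>i j. \<tau> i (Inl j)"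
  "\<lambda>i. x (Inl i)"
  by (rule interconnection)

definition leader_part :: "'f \<Rightarrow> real \<Rightarrow> 'a" where
  "leader_part i t = (\<Sum>j\<in>UNIV. P i j *\<^sub>R (case j of Inl _ \<Rightarrow> 0 | Inr l \<Rightarrow> x j (\<tau> i j t)))"

lemma mean_split: "mean x i t = I.input i t + leader_part i t"
  by (simp add: mean_def I.input_def leader_part_def sum_agents)

text \<open>The leaders add a bounded disturbance to the input from the followers. The signal
  \<open>x\<close> is generic because it is instantiated with velocity errors and with position
  errors.\<close>

lemma followers_bounded:
  assumes "\<And>i. continuous_on {0..} (x (Inl i))"
    and gain: "\<And>i. bounded_gain (mean x i) (x (Inl i))"
  shows "uniformly_bounded (x (Inl i))"
proof (rule I.bounded[OF assms(1)])
  fix i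
  have "uniformly_bounded (leader_part i)"
    unfolding leader_part_def
  proof (rule bounded_P_sum[where y = "\<lambda>j t. case j of Inl _ \<Rightarrow> 0 | Inr l \<Rightarrow> x j (\<tau> i j t)"])
    fix j assume "P i j > 0"
    then show "uniformly_bounded (\<lambda>t. case j of Inl _ \<Rightarrow> 0 | Inr l \<Rightarrow> x j (\<tau> i j t))"
      using uniformly_bounded_delayed[OF leaders, of "\<tau> i j"] delay[of i j]
      by (cases j) (simp_all add: uniformly_bounded_const)
  qed
  then show "bounded_gain (I.input i) (x (Inl i))"
    by (rule bounded_gain_trans[OF bounded_gain_perturb gain]) (rule mean_split)
qed

lemma followers_tendsto:
  assumes "\<And>l. (x (Inr l) \<longlongrightarrow> 0) at_top" and "\<And>i. uniformly_bounded (x (Inl i))"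
    and gain: "\<And>i. limit_gain (mean x i) (x (Inl i))"
  shows "(x (Inl i) \<longlongrightarrow> 0) at_top"
proof (rule I.tendsto_zero[OF _ assms(2)])
  show "filterlim (\<tau> i (Inl j)) at_top at_top" if "P i (Inl j) > 0" for i j
    by (rule filterlim_delayed[of D]) (use that delay in auto)
  fix i
  have "(leader_part i \<longlongrightarrow> 0) at_top"
    unfolding leader_part_def
  proof (rule tendsto_P_sum[where y = "\<lambda>j t. case j of Inl _ \<Rightarrow> 0 | Inr l \<Rightarrow> x j (\<tau> i j t)"])
    fix j assume "P i j > 0"
    then show "((\<lambda>t. case j of Inl _ \<Rightarrow> 0 | Inr l \<Rightarrow> x j (\<tau> i j t)) \<longlongrightarrow> 0) at_top"
      using tendsto_delayed[OF assms(1)] by (cases j) auto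
  qed
  then show "limit_gain (I.input i) (x (Inl i))"
    by (rule limit_gain_trans[OF limit_gain_perturb gain]) (rule mean_split)
qed

end

end


text \<open>Of the tracking properties only boundedness is assumed here. Vanishing errors become
  available only after the reference velocities and their derivatives are shown to be
  bounded.\<close>

locale closed_loop_solution = delayed_graph G D
  for G :: "('f::finite + 'l::finite) network" and D +
  fixes F :: "'f + 'l \<Rightarrow> real^'d::finite \<Rightarrow> real^'d \<Rightarrow> real^'d \<Rightarrow> real^'d"
    and K :: "'f gains"
    and \<Gamma> :: "'f + 'l \<Rightarrow> ('f, 'l, 'd) trajectory \<Rightarrow> (real \<Rightarrow> real^'d) set"
    and v :: "real^'d" and z :: "('f, 'l, 'd) trajectory" and u :: "'f + 'l \<Rightarrow> real \<Rightarrow> real^'d"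
  assumes gains: "positive_gains K" and loop: "closed_loop F G K \<Gamma> z u"
    and motion: "leader_motion F v z u"
    and error_bounded: "\<And>i. uniformly_bounded (velocity_error K z i)"
begin

lemma gain_pos: "lam K i > 0" "kp K i > 0" "kd K i > 0" "Lp K i > 0" "Ld K i > 0"
  using gains by (auto simp: positive_gains_def)

lemma ode_pos: "caratheodory (pos z j) (vel z j)"
  and ode_vel: "caratheodory (vel z j) (\<lambda>t. F j (pos z j t) (vel z j t) (u j t))"
  and vhat_leader: "t \<ge> 0 \<Longrightarrow> vhat z (Inr l) t = vel z (Inr l) t"
  and ode_eta1: "caratheodory (eta1 z i)
          (\<lambda>t. - kp K i *\<^sub>R (eta1 z i t - eta2 z i t) + vhat z (Inl i) t)"
  and ode_eta2: "caratheodory (eta2 z i)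
          (\<lambda>t. - kd K i *\<^sub>R (eta2 z i t
                 - weighted_mean G i (\<lambda>j. extrapolation G z (Inl i) j t))
               + vhat z (Inl i) t)"
  and ode_vhat: "caratheodory (vhat z (Inl i))
          (\<lambda>t. - Lp K i *\<^sub>R (vhat z (Inl i) t - sigma1 z i t))"
  and ode_sigma1: "caratheodory (sigma1 z i)
          (\<lambda>t. - Ld K i *\<^sub>R (sigma1 z i t
                 - weighted_mean G i (\<lambda>j. vhat z j (\<tau> i j t))))"
  using loop unfolding closed_loop_def by blast+

lemma leader_vel: "uniformly_bounded (vel z (Inr l))" "(vel z (Inr l) \<longlongrightarrow> v) at_top"
  using motion by (auto simp: leader_motion_def)

lemma leader_vhat: "uniformly_bounded (vhat z (Inr l))" "(vhat z (Inr l) \<longlongrightarrow> v) at_top"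
proof -
  show "uniformly_bounded (vhat z (Inr l))"
    by (rule uniformly_bounded_cong[OF leader_vel(1) vhat_leader])
  show "(vhat z (Inr l) \<longlongrightarrow> v) at_top"
    by (rule Lim_transform_eventually[OF leader_vel(2)])
      (use eventually_ge_at_top[of 0] in eventually_elim, simp add: vhat_leader)
qed

section \<open>Velocity estimates\<close>

definition w :: "'f + 'l \<Rightarrow> real \<Rightarrow> real^'d" where
  "w j t = vhat z j t - v"

lemma weighted_mean_w: "weighted_mean G i (\<lambda>j. vhat z j (\<tau> i j t)) = mean w i t + v"
proof -
  have "mean w i t = (\<Sum>j\<in>UNIV. P i j *\<^sub>R vhat z j (\<tau> i j t)) - (\<Sum>j\<in>UNIV. P i j) *\<^sub>R v"
    by (simp add: mean_def w_def scaleR_diff_right sum_subtractf scaleR_sum_left)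
  then show ?thesis by (simp add: sum_P weighted_mean_eq)
qed

text \<open>The weights of the mean sum to 1, so subtracting \<open>v\<close> preserves the filter
  equation.\<close>

lemma sigma1_gain:
  "bounded_gain (mean w i) (\<lambda>t. sigma1 z i t - v)" "limit_gain (mean w i) (\<lambda>t. sigma1 z i t - v)"
  by (rule low_pass_gain[OF caratheodory_diff[OF ode_sigma1 caratheodory_const] _ gain_pos(5)],
      simp add: weighted_mean_w algebra_simps)+

lemma w_gain: "bounded_gain (mean w i) (w (Inl i))" "limit_gain (mean w i) (w (Inl i))"
proof -
  have ode: "caratheodory (w (Inl i)) (\<lambda>t. - Lp K i *\<^sub>R (vhat z (Inl i) t - sigma1 z i t) - 0)"
    unfolding w_def by (rule caratheodory_diff[OF ode_vhat caratheodory_const])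
  have "bounded_gain (\<lambda>t. sigma1 z i t - v) (w (Inl i))" "limit_gain (\<lambda>t. sigma1 z i t - v) (w (Inl i))"
    by (rule low_pass_gain[OF ode _ gain_pos(4)], simp add: w_def algebra_simps)+
  then show "bounded_gain (mean w i) (w (Inl i))" "limit_gain (mean w i) (w (Inl i))"
    using sigma1_gain[of i] by (blast intro: bounded_gain_trans limit_gain_trans)+
qed

lemma w_leader: "uniformly_bounded (w (Inr l))" "(w (Inr l) \<longlongrightarrow> 0) at_top"
  unfolding w_def
  using uniformly_bounded_diff[OF leader_vhat(1) uniformly_bounded_const] LIM_zero[OF leader_vhat(2)]
  by auto

lemma w_bounded: "uniformly_bounded (w j)"
proof (cases j)
  case (Inl i)
  have "continuous_on {0..} (w (Inl k))" for k
    unfolding w_def by (intro continuous_intros caratheodory_continuous_on[OF ode_vhat])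
  then show ?thesis
    unfolding Inl using followers_bounded[of w] w_leader(1) w_gain(1) by blast
qed (simp add: w_leader)

lemma w_tendsto: "(w j \<longlongrightarrow> 0) at_top"
  using followers_tendsto[of w] w_leader w_gain(2) w_bounded by (cases j) blast+

lemma vhat_bounded: "uniformly_bounded (vhat z j)"
  using uniformly_bounded_add[OF w_bounded[of j] uniformly_bounded_const[of v]] by (simp add: w_def)

lemma vhat_tendsto: "(vhat z j \<longlongrightarrow> v) at_top"
  using w_tendsto[of j] unfolding w_def by (rule LIM_zero_cancel)

lemma sigma1_bounded: "uniformly_bounded (sigma1 z i)"
proof -
  have "uniformly_bounded (\<lambda>t. sigma1 z i t - v)"
    by (rule uniformly_bounded_gain[OF sigma1_gain(1) bounded_mean[OF w_bounded]])
  from uniformly_bounded_add[OF this uniformly_bounded_const[of v]] show ?thesis by simp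
qed

section \<open>Positions relative to the containment targets\<close>

definition Q :: "'f + 'l \<Rightarrow> real \<Rightarrow> real^'d" where
  "Q j t = (\<Sum>l\<in>UNIV. target j l *\<^sub>R pos z (Inr l) t)"

definition q :: "'f + 'l \<Rightarrow> real \<Rightarrow> real^'d" where
  "q j t = (\<Sum>l\<in>UNIV. target j l *\<^sub>R vel z (Inr l) t)"

definition x :: "'f + 'l \<Rightarrow> real \<Rightarrow> real^'d" where
  "x j t = pos z j t - Q j t"

text \<open>What remains of the extrapolated position of \<open>j\<close> after removing the delayed
  deviation \<open>x j\<close> and the current target \<open>Q j t\<close>.\<close>

definition b :: "'f \<Rightarrow> 'f + 'l \<Rightarrow> real \<Rightarrow> real^'d" where
  "b i j t = Q j (\<tau> i j t) + (t - \<tau> i j t) *\<^sub>R vhat z j (\<tau> i j t) - Q j t"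

lemma ode_Q: "caratheodory (Q j) (q j)"
  unfolding Q_def q_def by (intro caratheodory_sum caratheodory_scaleR ode_pos)

lemma Q_leader: "Q (Inr l) t = pos z (Inr l) t"
  by (simp add: Q_def target_def of_bool_def if_distrib[of "\<lambda>c. c *\<^sub>R _"] cong: if_cong)

lemma Q_mean: "Q (Inl i) t = (\<Sum>j\<in>UNIV. P i j *\<^sub>R Q j t)"
  unfolding Q_def target_mean scaleR_sum_right scaleR_sum_left scaleR_scaleR by (rule sum.swap)

lemma q_bounded: "uniformly_bounded (q j)"
  unfolding q_def by (intro uniformly_bounded_sum uniformly_bounded_scaleR leader_vel)

lemma q_tendsto: "(q j \<longlongrightarrow> v) at_top"
proof -
  have "(q j \<longlongrightarrow> (\<Sum>l\<in>UNIV. target j l *\<^sub>R v)) at_top"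
    unfolding q_def by (intro tendsto_intros leader_vel)
  then show ?thesis by (simp add: sum_target flip: scaleR_sum_left)
qed

lemma
  assumes "P i j > 0"
  shows b_bounded: "uniformly_bounded (b i j)" and b_tendsto: "(b i j \<longlongrightarrow> 0) at_top"
  unfolding b_def
  by (rule extrapolation_error[OF ode_Q q_bounded q_tendsto vhat_bounded vhat_tendsto
        delay[OF assms]]; assumption)+

lemma x_leader: "x (Inr l) = (\<lambda>t. 0)"
  by (simp add: fun_eq_iff x_def Q_leader)

text \<open>Rests on \<open>Q_mean\<close>: the targets of the neighbours average to the agent's own
  target. On edges, \<open>index\<close> identifies the elapsed time with
  \<open>t - \<tau> i j t\<close>.\<close>

lemma weighted_mean_extrapolation:
  "weighted_mean G i (\<lambda>j. extrapolation G z (Inl i) j t) =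
     mean x i t + (\<Sum>j\<in>UNIV. P i j *\<^sub>R b i j t) + Q (Inl i) t"
proof -
  have "P i j *\<^sub>R extrapolation G z (Inl i) j t =
      P i j *\<^sub>R x j (\<tau> i j t) + P i j *\<^sub>R b i j t + P i j *\<^sub>R Q j t" for j
  proof (cases "P i j = 0")
    case False
    then have "P i j > 0" using P_nonneg[of i j] by simp
    then show ?thesis
      by (simp add: extrapolation_def index x_def b_def flip: scaleR_add_right)
  qed simp
  then show ?thesis by (simp add: weighted_mean_eq mean_def Q_mean sum.distrib)
qed

text \<open>The mismatch between estimated velocity and target velocity is a disturbance in the
  equations for \<open>y2\<close>, \<open>y1\<close> and \<open>x\<close>; both velocities tend to
  \<open>v\<close>.\<close>

lemma feedforward:
  "uniformly_bounded (\<lambda>t. vhat z j t - q j t)" "((\<lambda>t. vhat z j t - q j t) \<longlongrightarrow> 0) at_top"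
  using uniformly_bounded_diff[OF vhat_bounded q_bounded] tendsto_diff[OF vhat_tendsto q_tendsto]
  by auto

definition y1 :: "'f \<Rightarrow> real \<Rightarrow> real^'d" where
  "y1 i t = eta1 z i t - Q (Inl i) t"

definition y2 :: "'f \<Rightarrow> real \<Rightarrow> real^'d" where
  "y2 i t = eta2 z i t - Q (Inl i) t"

text \<open>After subtracting the target, the filter is driven by \<open>mean x i\<close> up to
  extrapolation errors and the feedforward mismatch.\<close>

lemma y2_gain: "bounded_gain (mean x i) (y2 i)" "limit_gain (mean x i) (y2 i)"
proof -
  let ?g = "\<lambda>t. mean x i t + (\<Sum>j\<in>UNIV. P i j *\<^sub>R b i j t)"
  have 1: "bounded_gain (mean x i) ?g"
    by (rule bounded_gain_perturb[OF bounded_P_sum[where y = "b i"]]) (auto intro: b_bounded)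
  have 2: "limit_gain (mean x i) ?g"
    by (rule limit_gain_perturb[OF tendsto_P_sum[where y = "b i"]]) (auto intro: b_tendsto)
  have ode: "caratheodory (y2 i) (\<lambda>t. (- kd K i *\<^sub>R (eta2 z i t
                 - weighted_mean G i (\<lambda>j. extrapolation G z (Inl i) j t))
               + vhat z (Inl i) t) - q (Inl i) t)"
    unfolding y2_def by (rule caratheodory_diff[OF ode_eta2 ode_Q])
  note gain = low_pass_perturbed_gain[OF ode _ gain_pos(3)[of i],
      where g = "?g" and d = "\<lambda>t. vhat z (Inl i) t - q (Inl i) t"]
  have "bounded_gain ?g (y2 i)"
    by (rule gain(1)[OF _ feedforward(1)]) (simp add: weighted_mean_extrapolation y2_def algebra_simps)
  with 1 show "bounded_gain (mean x i) (y2 i)" by (rule bounded_gain_trans)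
  have "limit_gain ?g (y2 i)"
    by (rule gain(2)[OF _ feedforward(2)]) (simp add: weighted_mean_extrapolation y2_def algebra_simps)
  with 2 show "limit_gain (mean x i) (y2 i)" by (rule limit_gain_trans)
qed

lemma y1_gain: "bounded_gain (mean x i) (y1 i)" "limit_gain (mean x i) (y1 i)"
proof -
  have ode: "caratheodory (y1 i)
      (\<lambda>t. (- kp K i *\<^sub>R (eta1 z i t - eta2 z i t) + vhat z (Inl i) t) - q (Inl i) t)"
    unfolding y1_def by (rule caratheodory_diff[OF ode_eta1 ode_Q])
  note gain = low_pass_perturbed_gain[OF ode _ gain_pos(2)[of i],
      where g = "y2 i" and d = "\<lambda>t. vhat z (Inl i) t - q (Inl i) t"]
  have "bounded_gain (y2 i) (y1 i)"
    by (rule gain(1)[OF _ feedforward(1)]) (simp add: y1_def y2_def algebra_simps)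
  with y2_gain(1) show "bounded_gain (mean x i) (y1 i)" by (rule bounded_gain_trans)
  have "limit_gain (y2 i) (y1 i)"
    by (rule gain(2)[OF _ feedforward(2)]) (simp add: y1_def y2_def algebra_simps)
  with y2_gain(2) show "limit_gain (mean x i) (y1 i)" by (rule limit_gain_trans)
qed

lemma reference_eq: "reference_velocity K z i t = - lam K i *\<^sub>R (x (Inl i) t - y1 i t) + vhat z (Inl i) t"
  by (simp add: reference_velocity_def x_def y1_def)

lemma vel_eq: "vel z (Inl i) t = velocity_error K z i t + reference_velocity K z i t"
  by (simp add: velocity_error_def)

text \<open>The reference velocity makes the position a third filter of the cascade, with input
  \<open>y1\<close> and the tracking error as an additional disturbance.\<close>

lemma x_gain:
  shows "bounded_gain (mean x i) (x (Inl i))"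
    and "(velocity_error K z i \<longlongrightarrow> 0) at_top \<Longrightarrow> limit_gain (mean x i) (x (Inl i))"
proof -
  have ode: "caratheodory (x (Inl i)) (\<lambda>t. vel z (Inl i) t - q (Inl i) t)"
    unfolding x_def by (rule caratheodory_diff[OF ode_pos ode_Q])
  let ?d = "\<lambda>t. velocity_error K z i t + (vhat z (Inl i) t - q (Inl i) t)"
  note gain = low_pass_perturbed_gain[OF ode _ gain_pos(1)[of i],
      where g = "y1 i" and d = "?d"]
  have "bounded_gain (y1 i) (x (Inl i))"
    by (rule gain(1)[OF _ uniformly_bounded_add[OF error_bounded feedforward(1)]])
      (simp add: vel_eq reference_eq)
  with y1_gain(1) show "bounded_gain (mean x i) (x (Inl i))" by (rule bounded_gain_trans)
  assume "(velocity_error K z i \<longlongrightarrow> 0) at_top"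
  from tendsto_add[OF this feedforward(2)[of "Inl i"]] have "(?d \<longlongrightarrow> 0) at_top" by simp
  then have "limit_gain (y1 i) (x (Inl i))"
    by (rule gain(2)[rotated]) (simp add: vel_eq reference_eq)
  with y1_gain(2) show "limit_gain (mean x i) (x (Inl i))" by (rule limit_gain_trans)
qed

lemma x_bounded: "uniformly_bounded (x j)"
proof (cases j)
  case (Inl i)
  have "continuous_on {0..} (x (Inl k))" for k
    unfolding x_def
    by (intro continuous_intros caratheodory_continuous_on[OF ode_pos] caratheodory_continuous_on[OF ode_Q])
  then show ?thesis
    unfolding Inl using followers_bounded[of x] x_gain(1)
    by (simp add: x_leader uniformly_bounded_const)
qed (simp add: x_leader uniformly_bounded_const)

lemma y_bounded: "uniformly_bounded (y1 i)" "uniformly_bounded (y2 i)"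
  by (rule uniformly_bounded_gain[OF _ bounded_mean[OF x_bounded]], rule y1_gain y2_gain)+

lemma reference_bounded: "uniformly_bounded (reference_velocity K z i)"
  unfolding reference_eq
  by (intro uniformly_bounded_add uniformly_bounded_scaleR uniformly_bounded_diff
      x_bounded y_bounded vhat_bounded)

lemma vel_bounded: "uniformly_bounded (vel z (Inl i))"
  unfolding vel_eq by (intro uniformly_bounded_add error_bounded reference_bounded)

text \<open>The delayed, discontinuous data enter only the equations of \<open>eta2\<close> and
  \<open>sigma1\<close>. The position, \<open>eta1\<close> and the estimate have continuous
  right-hand sides, so the reference is classically differentiable.\<close>

lemma reference_derivative_bounded:
  "uniformly_bounded (\<lambda>t. vector_derivative (reference_velocity K z i) (at t within {0..}))"
proof -
  \<comment> \<open>Written with \<open>y1\<close> and \<open>y2\<close>, which are bounded, whereas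
    \<open>eta1\<close> and \<open>eta2\<close> may follow an unbounded target; the common target
    cancels in the difference.\<close>
  let ?e = "\<lambda>t. - kp K i *\<^sub>R (y1 i t - y2 i t) + vhat z (Inl i) t"
  let ?h = "\<lambda>t. - Lp K i *\<^sub>R (vhat z (Inl i) t - sigma1 z i t)"
  have e_eq: "?e t = - kp K i *\<^sub>R (eta1 z i t - eta2 z i t) + vhat z (Inl i) t" for t
    by (simp add: y1_def y2_def)
  note cont = caratheodory_continuous_on[OF ode_vel] caratheodory_continuous_on[OF ode_eta1]
    caratheodory_continuous_on[OF ode_eta2] caratheodory_continuous_on[OF ode_vhat]
    caratheodory_continuous_on[OF ode_sigma1]
  have deriv: "(reference_velocity K z i has_vector_derivative
      (- lam K i *\<^sub>R (vel z (Inl i) t - ?e t) + ?h t)) (at t within {0..})" if "t \<ge> 0" for t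
  proof -
    have "(pos z (Inl i) has_vector_derivative vel z (Inl i) t) (at t within {0..})"
      by (rule caratheodory_has_vector_derivative[OF ode_pos _ that]) (intro cont)
    moreover have "(eta1 z i has_vector_derivative ?e t) (at t within {0..})"
      unfolding e_eq
      by (rule caratheodory_has_vector_derivative[OF ode_eta1 _ that]) (intro continuous_intros cont)
    moreover have "(vhat z (Inl i) has_vector_derivative ?h t) (at t within {0..})"
      by (rule caratheodory_has_vector_derivative[OF ode_vhat _ that]) (intro continuous_intros cont)
    ultimately show ?thesis
      unfolding reference_velocity_def[abs_def]
      by (auto intro!: derivative_eq_intros)
  qed
  have "uniformly_bounded (\<lambda>t. - lam K i *\<^sub>R (vel z (Inl i) t - ?e t) + ?h t)"
    by (intro uniformly_bounded_add uniformly_bounded_scaleR uniformly_bounded_diff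
        vel_bounded y_bounded vhat_bounded sigma1_bounded)
  then show ?thesis
  proof (rule uniformly_bounded_cong)
    fix t :: real assume t: "t \<ge> 0"
    \<comment> \<open>Being a limit point of the half-line, \<open>t\<close> has a unique derivative
      within it, also for \<open>t = 0\<close>.\<close>
    have "{t<..<t + 1} \<subseteq> {0..}" using t by auto
    then have "t islimpt {0..}"
      by (rule islimpt_subset[OF islimpt_greaterThanLessThan1, rotated]) simp
    then show "vector_derivative (reference_velocity K z i) (at t within {0..}) =
        - lam K i *\<^sub>R (vel z (Inl i) t - ?e t) + ?h t"
      by (intro vector_derivative_within[OF _ deriv[OF t]]) (simp add: trivial_limit_within)
  qed
qed

lemma formation_error_eq: "formation_error G z t = stack (\<lambda>i. x (Inl i) t)"
proof -
  let ?M = "matrix_inv (laplacian1 G) ** laplacian2 G"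
  have "(kronecker ?M (mat 1 :: real^'d^'d) *v stack (\<lambda>l. pos z (Inr l) t)) $ (i, k) =
      - Q (Inl i) t $ k" for i k
  proof -
    have "(kronecker ?M (mat 1 :: real^'d^'d) *v stack (\<lambda>l. pos z (Inr l) t)) $ (i, k) =
        (\<Sum>l\<in>UNIV. \<Sum>c\<in>UNIV. ?M $ i $ l * (mat 1 :: real^'d^'d) $ k $ c * pos z (Inr l) t $ c)"
      by (simp add: matrix_vector_mult_def kronecker_def stack_def sum.cartesian_product
          UNIV_Times_UNIV[symmetric] split_def del: UNIV_Times_UNIV)
    also have "\<dots> = (\<Sum>l\<in>UNIV. ?M $ i $ l * pos z (Inr l) t $ k)"
      \<comment> \<open>The identity factor of the Kronecker product collapses the sum over the
        coordinate \<open>c\<close>.\<close>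
      by (simp add: mat_def if_distrib[of "\<lambda>c. _ * c"] if_distrib[of "\<lambda>c. c * _"] cong: if_cong)
    finally show ?thesis by (simp add: Q_def target_def sum_negf)
  qed
  then show ?thesis
    by (simp add: vec_eq_iff formation_error_def stack_def x_def split_paired_all)
qed

text \<open>Vanishing tracking errors leave only vanishing disturbances in the position loop. Then
  \<open>y1\<close> vanishes as well, and the reference velocity tends to the limit of the
  estimate.\<close>

lemma tracking:
  assumes error: "\<And>i. (velocity_error K z i \<longlongrightarrow> 0) at_top"
  shows "(x (Inl i) \<longlongrightarrow> 0) at_top" "(vel z (Inl i) \<longlongrightarrow> v) at_top"
proof -
  have x: "(x (Inl k) \<longlongrightarrow> 0) at_top" for k
    using followers_tendsto[of x] x_bounded x_gain(2)[OF error]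
    by (simp add: x_leader uniformly_bounded_const)
  then show "(x (Inl i) \<longlongrightarrow> 0) at_top" .
  have "(x j \<longlongrightarrow> 0) at_top" for j
    using x by (cases j) (simp_all add: x_leader)
  then have y: "(y1 i \<longlongrightarrow> 0) at_top"
    by (intro tendsto_zero_gain[OF y1_gain(2)] tendsto_mean)
  have "((\<lambda>t. velocity_error K z i t + (- lam K i *\<^sub>R (x (Inl i) t - y1 i t) + vhat z (Inl i) t)) \<longlongrightarrow>
      0 + (- lam K i *\<^sub>R (0 - 0) + v)) at_top"
    by (intro tendsto_intros error x y vhat_tendsto)
  then show "(vel z (Inl i) \<longlongrightarrow> v) at_top"
    unfolding vel_eq reference_eq by simp
qed

end

theorem theorem2:
  fixes F :: "'f::finite + 'l::finite
                \<Rightarrow> real^'d::finite \<Rightarrow> real^'d \<Rightarrow> real^'d \<Rightarrow> real^'d"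
    and G :: "('f + 'l) network"
    and K :: "'f gains"
    and \<Gamma> :: "'f + 'l \<Rightarrow> ('f, 'l, 'd) trajectory \<Rightarrow> (real \<Rightarrow> real^'d) set"
    and v\<^sub>d :: "real^'d"
  assumes "weighted_digraph G"
    and "leader_follower G"
    and "leader_rooted G"
    and "communication G"
    and "bounded_blackout G"
    and "common_sampling G"
    and "\<And>i. continuous_on UNIV (\<lambda>(x, y, w). F (Inl i) x y w)"
    and "\<And>i. local_lipschitz UNIV UNIV (\<lambda>t::real. \<lambda>(x, y, w). F (Inl i) x y w)"
    and "\<And>l x y w. F (Inr l) x y w = w"
    and "positive_gains K"
    and "\<And>z u. closed_loop F G K \<Gamma> z u \<Longrightarrow> leader_motion F v\<^sub>d z u"
    and "\<And>i z u. closed_loop F G K \<Gamma> z u \<Longrightarrow> uniformly_bounded (velocity_error K z i)"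
    and "\<And>i z u. closed_loop F G K \<Gamma> z u \<Longrightarrow>
           uniformly_bounded (\<lambda>t. vector_derivative (reference_velocity K z i) (at t within {0..})) \<Longrightarrow>
           uniformly_bounded (reference_velocity K z i) \<Longrightarrow>
           (velocity_error K z i \<longlongrightarrow> 0) at_top"
  shows "\<forall>z u. closed_loop F G K \<Gamma> z u \<longrightarrow>
           uniformly_bounded (\<lambda>t. stack (\<lambda>i. vel z (Inl i) t)) \<and>
           uniformly_bounded (formation_error G z) \<and>
           (\<forall>i. (vel z (Inl i) \<longlongrightarrow> v\<^sub>d) at_top) \<and>
           (formation_error G z \<longlongrightarrow> 0) at_top"
proof (intro allI impI)
  fix z u assume loop: "closed_loop F G K \<Gamma> z u"
  interpret leader_follower_graph G by standard fact+
  obtain D where D: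
    "\<And>i j t. (j, i) \<in> edges G \<Longrightarrow> t \<ge> 0 \<Longrightarrow>
       0 \<le> last_inst G i j t \<and> last_inst G i j t \<le> t \<and> t - D \<le> last_inst G i j t"
    "\<And>i j t. (j, i) \<in> edges G \<Longrightarrow> real (last_index G i j t) * period G = last_inst G i j t"
    using last_inst_delay[OF assms(4-6)] by metis
  interpret closed_loop_solution G D F K \<Gamma> v\<^sub>d z u
    by standard (use D P_pos_iff assms(10) loop assms(11,12)[OF loop] in auto)
  \<comment> \<open>The boundedness results used property (i) alone, so invoking property (ii) here
    is not circular.\<close>
  have error: "(velocity_error K z i \<longlongrightarrow> 0) at_top" for i
    by (rule assms(13)[OF loop reference_derivative_bounded reference_bounded])
  show "uniformly_bounded (\<lambda>t. stack (\<lambda>i. vel z (Inl i) t)) \<and>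
           uniformly_bounded (formation_error G z) \<and>
           (\<forall>i. (vel z (Inl i) \<longlongrightarrow> v\<^sub>d) at_top) \<and>
           (formation_error G z \<longlongrightarrow> 0) at_top"
  proof (intro conjI allI)
    show "uniformly_bounded (\<lambda>t. stack (\<lambda>i. vel z (Inl i) t))"
      by (rule bounded_stack[OF vel_bounded])
    show "uniformly_bounded (formation_error G z)"
      unfolding formation_error_eq[abs_def] by (rule bounded_stack[OF x_bounded])
    show "(vel z (Inl i) \<longlongrightarrow> v\<^sub>d) at_top" for i by (rule tracking(2)[OF error])
    have "((\<lambda>t. x (Inl i) t $ k) \<longlongrightarrow> 0) at_top" for i k
      using tendsto_vec_nth[OF tracking(1)[OF error, of i], of k] by simp
    then show "(formation_error G z \<longlongrightarrow> 0) at_top"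
      unfolding formation_error_eq[abs_def] by (intro vec_tendstoI) (simp add: stack_def)
  qed
qed

end
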